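(* Let $I\subset D_{xy}$ be the left ideal generated by $2\sum_{k=1}^d x_{ik}\partial_{y_i}\partial_{y_k}+y_i\partial_{y_i}+1$ ($1\le i\le d$), $\partial_{x_{ij}}-2\partial_{y_i}\partial_{y_j}$ ($1\le i<j\le d$), and $\partial_{x_{ii}}-\partial_{y_i}^2$ ($1\le i\le d$). Then the holonomic rank of $I$ is $\operatorname{rank} I=2^d$.
   Context: The variables are $x_{ij}$ ($1\le i\le j\le d$, with $x_{ij}=x_{ji}$) and $y_k$ ($1\le k\le d$), and $\partial_z=\partial/\partial z$. $D_{xy}$ is the Weyl algebra in these variables over $\mathbf{C}$, and $R=\mathbf{C}(x,y)\langle\partial_{x_{ij}},\partial_{y_k}\rangle$ is the ring of differential operators in these variables with rational function coefficients. The holonomic rank of $I$ is $\operatorname{rank}I=\dim_{\mathbf{C}(x,y)}R/RI$, where $RI$ is the left ideal of $R$ generated by $I$. *)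

theory Defs
  imports
    Complex_Main
    "HOL-Library.Poly_Mapping"
    "HOL-Library.Uprod"
    "HOL-Library.Countable"
    "HOL-Library.Cardinality"
    "HOL-Library.Extended_Nat"
    "HOL-Computational_Algebra.Fraction_Field"
    "HOL-Algebra.Generated_Rings"
    "Jordan_Normal_Form.Missing_VectorSpace"
begin

section \<open>The rational function field in the variables \<open>x\<^sub>i\<^sub>j = x\<^sub>j\<^sub>i\<close> and \<open>y\<^sub>k\<close>\<close>

text \<open>
  The number \<open>d\<close> is rendered as \<open>CARD('n)\<close> for a finite index type \<open>'n\<close>.  The variables \<open>x\<^sub>i\<^sub>j\<close>
  are indexed by unordered pairs with \<open>i = j\<close> allowed, so \<open>x\<^sub>i\<^sub>j\<close> and \<open>x\<^sub>j\<^sub>i\<close> are the same variable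
  and there are \<open>d(d+1)/2\<close> of them.
\<close>

datatype 'n xyvar = XVar "'n uprod" | YVar 'n

instance xyvar :: (finite) finite
proof
  have "(UNIV :: 'a xyvar set) \<subseteq> range XVar \<union> range YVar"
    using xyvar.exhaust by blast
  then show "finite (UNIV :: 'a xyvar set)"
    by (rule finite_subset) simp
qed

text \<open>
  The order on the variables is arbitrary and carries no meaning; it is there only because the
  library's instance of \<^class>\<open>idom\<close> for polynomials, which the fraction field needs, assumes
  linearly ordered variables.
\<close>

instantiation xyvar :: (finite) linorder
begin

definition less_eq_xyvar :: "'a xyvar \<Rightarrow> 'a xyvar \<Rightarrow> bool"
  where "less_eq_xyvar u v \<longleftrightarrow> to_nat u \<le> to_nat v"

definition less_xyvar :: "'a xyvar \<Rightarrow> 'a xyvar \<Rightarrow> bool"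
  where "less_xyvar u v \<longleftrightarrow> to_nat u < to_nat v"

instance
  by standard (auto simp: less_eq_xyvar_def less_xyvar_def)

end

type_synonym 'n xypoly = "('n xyvar \<Rightarrow>\<^sub>0 nat) \<Rightarrow>\<^sub>0 complex"

type_synonym 'n ratfun = "'n xypoly fract"

definition ratvar :: "'n::finite xyvar \<Rightarrow> 'n ratfun"
  where "ratvar v = Fract (Poly_Mapping.single (Poly_Mapping.single v 1) 1) 1"

definition xvar :: "'n::finite \<Rightarrow> 'n \<Rightarrow> 'n ratfun"
  where "xvar i j = ratvar (XVar (Upair i j))"

definition yvar :: "'n::finite \<Rightarrow> 'n ratfun"
  where "yvar k = ratvar (YVar k)"


section \<open>Partial derivatives\<close>

text \<open>The coefficient of a monomial \<open>m\<close> in \<open>\<partial>p/\<partial>v\<close> is \<open>(m\<^sub>v + 1)\<close> times the coefficient of \<open>m v\<close> in \<open>p\<close>.\<close>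

lift_definition poly_pd :: "'v \<Rightarrow> (('v \<Rightarrow>\<^sub>0 nat) \<Rightarrow>\<^sub>0 'a::comm_ring_1) \<Rightarrow> (('v \<Rightarrow>\<^sub>0 nat) \<Rightarrow>\<^sub>0 'a)"
  is "\<lambda>v p m. of_nat (Poly_Mapping.lookup m v + 1) * p (m + Poly_Mapping.single v 1)"
proof -
  fix v :: 'v and p :: "('v \<Rightarrow>\<^sub>0 nat) \<Rightarrow> 'a"
  assume "finite {m. p m \<noteq> 0}"
  then have "finite ((\<lambda>m. m + Poly_Mapping.single v 1) -` {m. p m \<noteq> 0})"
    by (rule finite_vimageI) (simp add: inj_on_def)
  then show "finite {m. of_nat (Poly_Mapping.lookup m v + 1) * p (m + Poly_Mapping.single v 1) \<noteq> 0}"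
    by (rule rev_finite_subset) auto
qed

lemma poly_pd_add: "poly_pd v (p + q) = poly_pd v p + poly_pd v q"
  by transfer (simp add: fun_eq_iff distrib_left)

lemma poly_pd_zero [simp]: "poly_pd v 0 = 0"
  by transfer simp

lemma poly_pd_uminus: "poly_pd v (- p) = - poly_pd v p"
  by (metis add_eq_0_iff poly_pd_add poly_pd_zero)

lemma poly_pd_single:
  "poly_pd v (Poly_Mapping.single m c) =
     Poly_Mapping.single (m - Poly_Mapping.single v 1) (of_nat (Poly_Mapping.lookup m v) * c)"
proof (rule poly_mapping_eqI)
  fix k
  show "Poly_Mapping.lookup (poly_pd v (Poly_Mapping.single m c)) k =
    Poly_Mapping.lookup (Poly_Mapping.single (m - Poly_Mapping.single v 1) (of_nat (Poly_Mapping.lookup m v) * c)) k"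
  proof (cases "m = k + Poly_Mapping.single v 1")
    case True
    then show ?thesis
      by (simp add: poly_pd.rep_eq lookup_single lookup_add)
  next
    case False
    have "Poly_Mapping.lookup m v = 0" if k: "m - Poly_Mapping.single v 1 = k"
    proof (rule ccontr)
      assume "Poly_Mapping.lookup m v \<noteq> 0"
      then have "m = k + Poly_Mapping.single v 1"
        unfolding k [symmetric]
        by (intro poly_mapping_eqI) (auto simp: lookup_add lookup_minus lookup_single when_def)
      with False show False ..
    qed
    with False show ?thesis
      by (auto simp: poly_pd.rep_eq lookup_single when_def)
  qed
qed

lemma poly_additive_induct:
  assumes "P 0" "\<And>m c. P (Poly_Mapping.single m c)" "\<And>p q. P p \<Longrightarrow> P q \<Longrightarrow> P (p + q)"
  shows "P (p :: 'b \<Rightarrow>\<^sub>0 'a::comm_ring_1)"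
proof (induction p rule: update_induct)
  case const
  then show ?case using assms(1) by simp
next
  case (update f a b)
  have "Poly_Mapping.update a b f = f + Poly_Mapping.single a b"
    using update(1)
    by (intro poly_mapping_eqI)
      (auto simp: lookup_update lookup_add lookup_single when_def in_keys_iff)
  then show ?case using assms(2,3) update by simp
qed

lemma poly_pd_mult_single:
  "poly_pd v (Poly_Mapping.single m c * Poly_Mapping.single n e) =
     poly_pd v (Poly_Mapping.single m c) * Poly_Mapping.single n e +
     Poly_Mapping.single m c * poly_pd v (Poly_Mapping.single n e)"
proof -
  let ?e = "Poly_Mapping.single v (1::nat)"
  have shift: "a + b - ?e = (a - ?e) + b" if "Poly_Mapping.lookup a v \<noteq> 0" for a b :: "'a \<Rightarrow>\<^sub>0 nat"
    using that
    by (intro poly_mapping_eqI) (auto simp: lookup_add lookup_minus lookup_single when_def)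
  have 1: "Poly_Mapping.single (m - ?e + n) (of_nat (Poly_Mapping.lookup m v) * c * e) =
           Poly_Mapping.single (m + n - ?e) (of_nat (Poly_Mapping.lookup m v) * c * e)"
    using shift [of m n] by (cases "Poly_Mapping.lookup m v = 0") auto
  have 2: "Poly_Mapping.single (m + (n - ?e)) (c * (of_nat (Poly_Mapping.lookup n v) * e)) =
           Poly_Mapping.single (m + n - ?e) (c * (of_nat (Poly_Mapping.lookup n v) * e))"
    using shift [of n m] by (cases "Poly_Mapping.lookup n v = 0") (auto simp: add.commute)
  show ?thesis
    unfolding poly_pd_single mult_single 1 2
    by (simp add: lookup_add algebra_simps flip: single_add)
qed

lemma poly_pd_mult: "poly_pd v (p * q) = poly_pd v p * q + p * poly_pd v q"
proof (induction p rule: poly_additive_induct)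
  case (2 m c)
  show ?case
  proof (induction q rule: poly_additive_induct)
    case (2 n e)
    show ?case by (rule poly_pd_mult_single)
  qed (simp_all add: distrib_left poly_pd_add algebra_simps)
qed (simp_all add: distrib_right poly_pd_add algebra_simps)

text \<open>On fractions: the quotient rule.\<close>

lift_definition pd :: "'n::finite xyvar \<Rightarrow> 'n ratfun \<Rightarrow> 'n ratfun"
  is "\<lambda>v (a, b). (poly_pd v a * b - a * poly_pd v b, b * b)"
proof -
  fix v :: "'n xyvar" and r s :: "'n xypoly \<times> 'n xypoly"
  obtain a b c d where r: "r = (a, b)" and s: "s = (c, d)" by fastforce
  assume "fractrel r s"
  then have nz: "b \<noteq> 0" "d \<noteq> 0" and eq: "a * d = c * b" by (auto simp: r s)
  let ?D = "poly_pd v"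
  have D: "?D a * d + a * ?D d = ?D c * b + c * ?D b"
    using arg_cong [OF eq, of ?D] by (simp add: poly_pd_mult)
  have "(?D a * b - a * ?D b) * (d * d) - (?D c * d - c * ?D d) * (b * b) =
        b * d * ((?D a * d + a * ?D d) - (?D c * b + c * ?D b))
        + (c * b - a * d) * (b * ?D d + d * ?D b)"
    by (simp add: algebra_simps)
  then have "(?D a * b - a * ?D b) * (d * d) = (?D c * d - c * ?D d) * (b * b)"
    using D eq by simp
  then show "fractrel (case r of (a, b) \<Rightarrow> (?D a * b - a * ?D b, b * b))
                      (case s of (a, b) \<Rightarrow> (?D a * b - a * ?D b, b * b))"
    using nz by (simp add: r s)
qed

lemma pd_Fract:
  "b \<noteq> 0 \<Longrightarrow> pd v (Fract a b) = Fract (poly_pd v a * b - a * poly_pd v b) (b * b)"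
  by (simp add: Fract.abs_eq pd.abs_eq eq_onp_def)

lemma pd_add: "pd v (f + g) = pd v f + pd v g"
proof -
  obtain a b where f: "f = Fract a b" "b \<noteq> 0" by (rule Fract_cases)
  obtain c d where g: "g = Fract c d" "d \<noteq> 0" by (rule Fract_cases)
  let ?D = "poly_pd v"
  have "?D (a * d + c * b) * (b * d) - (a * d + c * b) * ?D (b * d) =
        (?D a * b - a * ?D b) * (d * d) + (?D c * d - c * ?D d) * (b * b)"
    unfolding poly_pd_add poly_pd_mult by (simp add: algebra_simps)
  moreover have "(b * d) * (b * d) = (b * b) * (d * d)" by (simp only: ac_simps)
  ultimately show ?thesis
    using f(2) g(2) by (simp only: f(1) g(1) add_fract pd_Fract mult_eq_0_iff simp_thms)
qed

lemma pd_mult: "pd v (f * g) = pd v f * g + f * pd v g"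
proof -
  obtain a b where f: "f = Fract a b" "b \<noteq> 0" by (rule Fract_cases)
  obtain c d where g: "g = Fract c d" "d \<noteq> 0" by (rule Fract_cases)
  let ?D = "poly_pd v"
  let ?N = "?D (a * c) * (b * d) - (a * c) * ?D (b * d)"
  have "(b * d) * ?N =
        ((?D a * b - a * ?D b) * c) * (b * (d * d)) + (a * (?D c * d - c * ?D d)) * (b * b * d)"
    unfolding poly_pd_mult by (simp add: algebra_simps)
  moreover have "(b * d) * ((b * d) * (b * d)) = (b * b * d) * (b * (d * d))"
    by (simp only: ac_simps)
  moreover have "pd v (f * g) = Fract ((b * d) * ?N) ((b * d) * ((b * d) * (b * d)))"
    using f(2) g(2)
    by (simp only: f(1) g(1) mult_fract pd_Fract mult_fract_cancel mult_eq_0_iff simp_thms)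
  ultimately show ?thesis
    using f(2) g(2)
    by (simp only: f(1) g(1) mult_fract add_fract pd_Fract mult_eq_0_iff simp_thms)
qed

abbreviation dx :: "'n::finite \<Rightarrow> 'n \<Rightarrow> 'n ratfun \<Rightarrow> 'n ratfun"
  where "dx i j \<equiv> pd (XVar (Upair i j))"

abbreviation dy :: "'n::finite \<Rightarrow> 'n ratfun \<Rightarrow> 'n ratfun"
  where "dy k \<equiv> pd (YVar k)"


section \<open>Rings of differential operators\<close>

text \<open>
  Differential operators are realised as operators on \<open>\<complex>(x,y)\<close>, multiplication being composition.
  In characteristic 0 this agrees with the presentation by generators and the relations
  \<open>\<partial>\<^sub>v f = f \<partial>\<^sub>v + \<partial>f/\<partial>v\<close>, because that ring acts faithfully on \<open>\<complex>(x,y)\<close>.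
\<close>

definition endo_ring :: "('a::ab_group_add \<Rightarrow> 'a) ring"
  where "endo_ring =
    \<lparr>carrier = {P. \<forall>f g. P (f + g) = P f + P g}, mult = (\<circ>), one = id,
     zero = (\<lambda>_. 0), add = (\<lambda>P Q f. P f + Q f)\<rparr>"

definition mulop :: "'n::finite ratfun \<Rightarrow> 'n ratfun \<Rightarrow> 'n ratfun"
  where "mulop f = (\<lambda>g. f * g)"

definition diffops :: "'n::finite ratfun set \<Rightarrow> ('n ratfun \<Rightarrow> 'n ratfun) ring"
  where "diffops A = endo_ring\<lparr>carrier := generate_ring endo_ring (mulop ` A \<union> range pd)\<rparr>"

definition weyl_algebra :: "('n::finite ratfun \<Rightarrow> 'n ratfun) ring"
  where "weyl_algebra = diffops (range (\<lambda>p. Fract p 1))"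

definition rat_diffops :: "('n::finite ratfun \<Rightarrow> 'n ratfun) ring"
  where "rat_diffops = diffops UNIV"

lemma endo_ring_ring: "ring (endo_ring :: ('a::ab_group_add \<Rightarrow> 'a) ring)"
proof (rule ringI)
  show "abelian_group (endo_ring :: ('a \<Rightarrow> 'a) ring)"
  proof (rule abelian_groupI)
    fix P :: "'a \<Rightarrow> 'a"
    assume "P \<in> carrier endo_ring"
    then show "\<exists>Q\<in>carrier endo_ring. Q \<oplus>\<^bsub>endo_ring\<^esub> P = \<zero>\<^bsub>endo_ring\<^esub>"
      by (intro bexI [of _ "\<lambda>f. - P f"]) (auto simp: endo_ring_def)
  qed (simp_all add: endo_ring_def ac_simps)
  show "monoid (endo_ring :: ('a \<Rightarrow> 'a) ring)"
    by (rule monoidI) (simp_all add: endo_ring_def comp_assoc)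
qed (simp_all add: endo_ring_def comp_def)

lemma diffops_ring: "ring (diffops (A :: 'n::finite ratfun set))"
proof -
  interpret ring "endo_ring :: ('n ratfun \<Rightarrow> 'n ratfun) ring" by (rule endo_ring_ring)
  have "mulop ` A \<union> range pd \<subseteq> carrier endo_ring"
    by (auto simp: endo_ring_def mulop_def pd_add distrib_left)
  then show ?thesis
    unfolding diffops_def by (intro subring_is_ring generate_ring_is_subring)
qed


section \<open>Left ideals and the holonomic rank\<close>

definition left_ideal :: "'a set \<Rightarrow> ('a, 'b) ring_scheme \<Rightarrow> bool"
  where "left_ideal J R \<longleftrightarrow>
    additive_subgroup J R \<and> (\<forall>P\<in>carrier R. \<forall>Q\<in>J. P \<otimes>\<^bsub>R\<^esub> Q \<in> J)"

definition gen_left_ideal :: "('a, 'b) ring_scheme \<Rightarrow> 'a set \<Rightarrow> 'a set"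
  where "gen_left_ideal R S = \<Inter>{J. left_ideal J R \<and> S \<subseteq> J}"

lemma (in ring) gen_left_ideal_left_ideal:
  assumes "S \<subseteq> carrier R"
  shows "left_ideal (gen_left_ideal R S) R"
proof -
  let ?F = "{J. left_ideal J R \<and> S \<subseteq> J}"
  have "additive_subgroup (carrier R) R"
    by (intro additive_subgroup.intro group.subgroup_self [OF a_group, simplified])
  then have ne: "carrier R \<in> ?F"
    using assms by (simp add: left_ideal_def)
  have "subgroup (\<Inter>?F) (add_monoid R)"
    using ne
    by (intro group.subgroups_Inter [OF a_group])
      (auto simp: left_ideal_def dest: additive_subgroup.a_subgroup)
  then show ?thesis
    unfolding gen_left_ideal_def
    by (auto simp: left_ideal_def intro: additive_subgroup.intro)
qed

definition ratfun_field :: "'n::finite ratfun ring"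
  where "ratfun_field = \<lparr>carrier = UNIV, mult = (*), one = 1, zero = 0, add = (+)\<rparr>"

text \<open>
  The vector space \<open>R/J\<close> over \<open>\<complex>(x,y)\<close> for a left ideal \<open>J\<close> of \<open>R\<close>.  The components \<open>mult\<close> and
  \<open>one\<close> are inherited from the record of rings and play no role for modules.
\<close>

definition quot_module ::
    "('n::finite ratfun \<Rightarrow> 'n ratfun) set \<Rightarrow> ('n ratfun, ('n ratfun \<Rightarrow> 'n ratfun) set) module"
  where "quot_module J =
    \<lparr>carrier = a_rcosets\<^bsub>rat_diffops\<^esub> J, mult = undefined, one = undefined,
     zero = J, add = set_add rat_diffops,
     smult = (\<lambda>f A. \<Union>P\<in>A. J +>\<^bsub>rat_diffops\<^esub> (mulop f \<otimes>\<^bsub>rat_diffops\<^esub> P))\<rparr>"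

lemma quot_module_vectorspace:
  fixes J :: "('n::finite ratfun \<Rightarrow> 'n ratfun) set"
  assumes J: "left_ideal J rat_diffops"
  shows "vectorspace ratfun_field (quot_module J)"
proof -
  let ?R = "rat_diffops :: ('n ratfun \<Rightarrow> 'n ratfun) ring"
  interpret R: ring ?R unfolding rat_diffops_def by (rule diffops_ring)
  have J': "additive_subgroup J ?R" and absorb: "\<And>P Q. P \<in> carrier ?R \<Longrightarrow> Q \<in> J \<Longrightarrow> P \<otimes>\<^bsub>?R\<^esub> Q \<in> J"
    using J by (auto simp: left_ideal_def)
  interpret J: abelian_subgroup J ?R
    using J' R.abelian_group_axioms by (rule abelian_subgroupI3)
  have mulop: "mulop f \<in> carrier ?R" for f
    by (auto simp: rat_diffops_def diffops_def intro: generate_ring.incl)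
  have coset_eq: "J +>\<^bsub>?R\<^esub> P = J +>\<^bsub>?R\<^esub> Q"
    if "P \<in> J +>\<^bsub>?R\<^esub> Q" "Q \<in> carrier ?R" for P Q
    using R.a_repr_independence [OF that J.a_subgroup] by simp
  have smult: "f \<odot>\<^bsub>quot_module J\<^esub> (J +>\<^bsub>?R\<^esub> P) = J +>\<^bsub>?R\<^esub> (mulop f \<otimes>\<^bsub>?R\<^esub> P)"
    if P: "P \<in> carrier ?R" for f P
  proof -
    have "J +>\<^bsub>?R\<^esub> (mulop f \<otimes>\<^bsub>?R\<^esub> Q) = J +>\<^bsub>?R\<^esub> (mulop f \<otimes>\<^bsub>?R\<^esub> P)"
      if Q: "Q \<in> J +>\<^bsub>?R\<^esub> P" for Q
    proof -
      obtain h where h: "h \<in> J" "Q = h \<oplus>\<^bsub>?R\<^esub> P"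
        using Q by (auto simp: a_r_coset_def')
      then have "mulop f \<otimes>\<^bsub>?R\<^esub> Q = (mulop f \<otimes>\<^bsub>?R\<^esub> h) \<oplus>\<^bsub>?R\<^esub> (mulop f \<otimes>\<^bsub>?R\<^esub> P)"
        using P mulop by (simp add: R.r_distr)
      then have "mulop f \<otimes>\<^bsub>?R\<^esub> Q \<in> J +>\<^bsub>?R\<^esub> (mulop f \<otimes>\<^bsub>?R\<^esub> P)"
        using absorb [OF mulop h(1)] by (auto simp: a_r_coset_def')
      then show ?thesis
        using P mulop by (intro coset_eq) auto
    qed
    moreover have "P \<in> J +>\<^bsub>?R\<^esub> P"
      using P by (rule J.a_rcos_self)
    ultimately have "(\<Union>Q\<in>J +>\<^bsub>?R\<^esub> P. J +>\<^bsub>?R\<^esub> (mulop f \<otimes>\<^bsub>?R\<^esub> Q)) =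
        J +>\<^bsub>?R\<^esub> (mulop f \<otimes>\<^bsub>?R\<^esub> P)"
      by blast
    then show ?thesis
      by (simp only: quot_module_def module.simps)
  qed
  have carr: "carrier (quot_module J) = (\<lambda>P. J +>\<^bsub>?R\<^esub> P) ` carrier ?R"
    by (auto simp: quot_module_def A_RCOSETS_def')
  have add: "(J +>\<^bsub>?R\<^esub> P) \<oplus>\<^bsub>quot_module J\<^esub> (J +>\<^bsub>?R\<^esub> Q) = J +>\<^bsub>?R\<^esub> (P \<oplus>\<^bsub>?R\<^esub> Q)"
    if "P \<in> carrier ?R" "Q \<in> carrier ?R" for P Q
    using J.a_rcos_sum [OF that] by (simp add: quot_module_def)
  have ops: "mulop f \<otimes>\<^bsub>?R\<^esub> (mulop g \<otimes>\<^bsub>?R\<^esub> P) = mulop (f * g) \<otimes>\<^bsub>?R\<^esub> P"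
    "(mulop f \<otimes>\<^bsub>?R\<^esub> P) \<oplus>\<^bsub>?R\<^esub> (mulop g \<otimes>\<^bsub>?R\<^esub> P) = mulop (f + g) \<otimes>\<^bsub>?R\<^esub> P"
    "mulop 1 \<otimes>\<^bsub>?R\<^esub> P = P" for f g P
    by (simp_all add: rat_diffops_def diffops_def endo_ring_def mulop_def fun_eq_iff algebra_simps)
  have field: "Ring.field (ratfun_field :: 'n ratfun ring)"
  proof (rule cring.cring_fieldI2)
    show "cring (ratfun_field :: 'n ratfun ring)"
    proof (rule cringI)
      show "abelian_group (ratfun_field :: 'n ratfun ring)"
      proof (rule abelian_groupI)
        fix f :: "'n ratfun"
        show "\<exists>g\<in>carrier ratfun_field. g \<oplus>\<^bsub>ratfun_field\<^esub> f = \<zero>\<^bsub>ratfun_field\<^esub>"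
          by (intro bexI [of _ "- f"]) (simp_all add: ratfun_field_def)
      qed (simp_all add: ratfun_field_def ac_simps)
      show "comm_monoid (ratfun_field :: 'n ratfun ring)"
        by (rule comm_monoidI) (simp_all add: ratfun_field_def ac_simps)
    qed (simp_all add: ratfun_field_def distrib_right)
    fix f :: "'n ratfun"
    assume "f \<noteq> \<zero>\<^bsub>ratfun_field\<^esub>"
    then show "\<exists>g\<in>carrier ratfun_field. f \<otimes>\<^bsub>ratfun_field\<^esub> g = \<one>\<^bsub>ratfun_field\<^esub>"
      by (intro bexI [of _ "inverse f"]) (simp_all add: ratfun_field_def)
  qed (simp add: ratfun_field_def)
  interpret K: Ring.field "ratfun_field :: 'n ratfun ring" by (rule field)
  have "Module.module ratfun_field (quot_module J)"
  proof (rule moduleI)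
    show "cring (ratfun_field :: 'n ratfun ring)"
      by (rule K.is_cring)
    have zero: "\<zero>\<^bsub>quot_module J\<^esub> = J +>\<^bsub>?R\<^esub> \<zero>\<^bsub>?R\<^esub>"
      using J.a_subset by (simp add: quot_module_def R.a_coset_add_zero)
    show "abelian_group (quot_module J)"
    proof (rule abelian_groupI)
      fix A
      assume "A \<in> carrier (quot_module J)"
      then obtain P where P: "P \<in> carrier ?R" "A = J +>\<^bsub>?R\<^esub> P"
        by (auto simp: carr)
      then show "\<exists>B\<in>carrier (quot_module J). B \<oplus>\<^bsub>quot_module J\<^esub> A = \<zero>\<^bsub>quot_module J\<^esub>"
        by (intro bexI [of _ "J +>\<^bsub>?R\<^esub> (\<ominus>\<^bsub>?R\<^esub> P)"]) (simp_all add: add zero carr R.l_neg)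
    qed (auto simp: carr add zero R.a_ac)
    fix f g :: "'n ratfun" and A B
    assume "A \<in> carrier (quot_module J)" "B \<in> carrier (quot_module J)"
    then obtain P Q where PQ: "P \<in> carrier ?R" "A = J +>\<^bsub>?R\<^esub> P"
        "Q \<in> carrier ?R" "B = J +>\<^bsub>?R\<^esub> Q"
      by (auto simp: carr)
    show "f \<odot>\<^bsub>quot_module J\<^esub> A \<in> carrier (quot_module J)"
      using PQ mulop by (simp add: carr smult)
    show "(f \<oplus>\<^bsub>ratfun_field\<^esub> g) \<odot>\<^bsub>quot_module J\<^esub> A =
        f \<odot>\<^bsub>quot_module J\<^esub> A \<oplus>\<^bsub>quot_module J\<^esub> g \<odot>\<^bsub>quot_module J\<^esub> A"
      using PQ mulop by (simp add: smult add ops) (simp add: ratfun_field_def)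
    show "f \<odot>\<^bsub>quot_module J\<^esub> (A \<oplus>\<^bsub>quot_module J\<^esub> B) =
        f \<odot>\<^bsub>quot_module J\<^esub> A \<oplus>\<^bsub>quot_module J\<^esub> f \<odot>\<^bsub>quot_module J\<^esub> B"
      using PQ mulop by (simp add: smult add R.r_distr)
    show "(f \<otimes>\<^bsub>ratfun_field\<^esub> g) \<odot>\<^bsub>quot_module J\<^esub> A =
        f \<odot>\<^bsub>quot_module J\<^esub> (g \<odot>\<^bsub>quot_module J\<^esub> A)"
      using PQ mulop by (simp add: smult ops) (simp add: ratfun_field_def)
    show "\<one>\<^bsub>ratfun_field\<^esub> \<odot>\<^bsub>quot_module J\<^esub> A = A"
      using PQ by (simp add: ratfun_field_def smult ops)
  qed
  then show ?thesis
    by (intro vectorspace.intro field)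
qed

definition holonomic_rank :: "('n::finite ratfun \<Rightarrow> 'n ratfun) set \<Rightarrow> enat"
  where "holonomic_rank I =
    (let M = quot_module (gen_left_ideal rat_diffops I)
     in if vectorspace.fin_dim ratfun_field M then enat (vectorspace.dim ratfun_field M) else \<infinity>)"

end

theory Submission
  imports
    Defs
    "HOL-Computational_Algebra.Polynomial"
    "HOL-Library.Multiset"
    "HOL-Analysis.Cartesian_Space"
begin

text \<open>
  Modulo the ideal every derivative becomes a polynomial in the \<open>\<partial>\<^sub>y\<close>, and the first family of
  generators says that \<open>2 \<Sum>\<^sub>k x\<^sub>i\<^sub>k \<partial>\<^sub>k \<partial>\<^sup>\<beta>\<close> is of lower order whenever \<open>i\<close> occurs in \<open>\<beta>\<close>.  The
  principal submatrices of \<open>(x\<^sub>i\<^sub>k)\<close> are invertible, so a monomial \<open>\<partial>\<^sup>\<beta>\<close> with a repeated index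
  reduces to monomials of lower order or with more distinct indices.  Hence the \<open>2\<^sup>d\<close> squarefree
  monomials \<open>\<partial>\<^sup>S\<close> span.

  For independence, consider the valuation \<open>ord\<close> of the rational function field given by the order
  of vanishing at the point \<open>p\<close> with \<open>x\<^sub>i\<^sub>i = 1/2\<close> and all other coordinates \<open>0\<close>.  The system has
  formal power series solutions \<open>F\<^sub>T\<close> at \<open>p\<close>, one for each set \<open>T\<close> of indices, with
  \<open>\<partial>\<^sup>S F\<^sub>T (p) = 1\<close> for \<open>S = T\<close> and \<open>0\<close> otherwise.  Every operator with rational coefficients
  lowers \<open>ord\<close> by at most a constant, so an operator in the ideal maps the truncations of \<open>F\<^sub>T\<close> to
  functions of order tending to infinity.  For a nontrivial combination \<open>\<Sum> a\<^sub>S \<partial>\<^sup>S\<close> this fails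
  at the \<open>T\<close> for which \<open>ord a\<^sub>T\<close> is minimal.
\<close>

section \<open>Order of vanishing at the base point\<close>

text \<open>Monomials are products of powers of variables, so a property stable under sums and
  products needs to be checked on constants and variables only.\<close>

lemma xypoly_induct [case_names const var add mult]:
  fixes p :: "('v \<Rightarrow>\<^sub>0 nat) \<Rightarrow>\<^sub>0 'a::comm_ring_1"
  assumes const: "\<And>c. P (Poly_Mapping.single 0 c)"
    and var: "\<And>v. P (Poly_Mapping.single (Poly_Mapping.single v 1) 1)"
    and add: "\<And>p q. P p \<Longrightarrow> P q \<Longrightarrow> P (p + q)"
    and mult: "\<And>p q. P p \<Longrightarrow> P q \<Longrightarrow> P (p * q)"
  shows "P p"
proof (induction p rule: poly_additive_induct)
  case 1
  show ?case using const [of 0] by simp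
next
  case (2 m c)
  have pow: "P (Poly_Mapping.single (Poly_Mapping.single v k) 1)" for v k
  proof (induction k)
    case 0
    then show ?case using const [of 1] by simp
  next
    case (Suc k)
    then show ?case
      using mult [OF Suc var [of v]] by (simp add: mult_single flip: single_add)
  qed
  have "P (Poly_Mapping.single m 1)"
  proof (induction m rule: update_induct)
    case const
    then show ?case using assms(1) [of 1] by simp
  next
    case (update f a b)
    have "Poly_Mapping.update a b f = f + Poly_Mapping.single a b"
      using update(1)
      by (intro poly_mapping_eqI)
        (auto simp: lookup_update lookup_add lookup_single when_def in_keys_iff)
    then show ?case using mult [OF update(3) pow [of a b]] by (simp add: mult_single)
  qed
  from mult [OF const [of c] this] show ?case by (simp add: mult_single)
qed (rule add)

text \<open>At this point the matrix \<open>2 * xvar i k\<close> is the identity, and so are all its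
  principal submatrices. With the x frozen here, the first family of generators decouples into one
  ordinary equation per index.\<close>

definition basept :: "'n xyvar \<Rightarrow> complex"
  where "basept v = (if \<exists>i. v = XVar (Upair i i) then 1 / 2 else 0)"

definition line :: "'n::finite xyvar \<Rightarrow> 'n xypoly poly"
  where "line v = [:Poly_Mapping.single 0 (basept v),
    Poly_Mapping.single (Poly_Mapping.single v 1) 1 - Poly_Mapping.single 0 (basept v):]"

text \<open>The coefficient of \<open>t\<^sup>k\<close> in \<open>p(b + t(X - b))\<close>, \<open>b\<close> the base point, is the homogeneous part of
  degree \<open>k\<close> of the Taylor expansion of \<open>p\<close> at \<open>b\<close>.\<close>

definition on_line :: "'n::finite xypoly \<Rightarrow> 'n xypoly poly"
  where "on_line p = (\<Sum>m\<in>Poly_Mapping.keys p.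
    [:Poly_Mapping.single 0 (Poly_Mapping.lookup p m):] * (\<Prod>v\<in>UNIV. line v ^ Poly_Mapping.lookup m v))"

lemma on_line_superset:
  assumes "finite A" "Poly_Mapping.keys p \<subseteq> A"
  shows "on_line p = (\<Sum>m\<in>A.
    [:Poly_Mapping.single 0 (Poly_Mapping.lookup p m):] * (\<Prod>v\<in>UNIV. line v ^ Poly_Mapping.lookup m v))"
  unfolding on_line_def using assms
  by (intro sum.mono_neutral_left) (auto simp: in_keys_iff)

lemma on_line_single:
  "on_line (Poly_Mapping.single m c) =
    [:Poly_Mapping.single 0 c:] * (\<Prod>v\<in>UNIV. line v ^ Poly_Mapping.lookup m v)"
  by (subst on_line_superset [of "{m}"]) auto

lemma on_line_add: "on_line (p + q) = on_line p + on_line q"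
proof -
  let ?A = "Poly_Mapping.keys p \<union> Poly_Mapping.keys q"
  have "Poly_Mapping.keys (p + q) \<subseteq> ?A" by (rule keys_add)
  then show ?thesis
    by (subst (1 2 3) on_line_superset [of ?A])
      (auto simp: lookup_add single_add sum.distrib smult_add_left)
qed

lemma on_line_0 [simp]: "on_line 0 = 0"
  by (simp add: on_line_def)

lemma on_line_const: "on_line (Poly_Mapping.single 0 c) = [:Poly_Mapping.single 0 c:]"
  by (simp add: on_line_single)

lemma on_line_1 [simp]: "on_line 1 = 1"
  using on_line_const [of 1] by (simp add: one_pCons)

lemma on_line_var: "on_line (Poly_Mapping.single (Poly_Mapping.single v 1) 1) = line v"
proof -
  have "(\<Prod>w\<in>UNIV. line w ^ (Poly_Mapping.lookup (Poly_Mapping.single v 1) w)) =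
      (\<Prod>w\<in>UNIV. if w = v then line w else 1)"
    by (intro prod.cong) (auto simp: lookup_single)
  then show ?thesis by (simp add: on_line_single one_pCons)
qed

lemma on_line_mult: "on_line (p * q) = on_line p * on_line q"
proof (induction p rule: poly_additive_induct)
  case (2 m c)
  show ?case
  proof (induction q rule: poly_additive_induct)
    case (2 n e)
    show ?case
      by (simp add: mult_single on_line_single lookup_add power_add prod.distrib ac_simps)
  qed (simp_all add: distrib_left on_line_add)
qed (simp_all add: distrib_right on_line_add)

text \<open>At t = 1 the line b + t(X - b) reaches the generic point X. So \<open>on_line\<close> is
  injective, and every nonzero polynomial has a finite order at the base point.\<close>

lemma poly_on_line_1: "poly (on_line p) 1 = p"
  by (induction p rule: xypoly_induct)
    (simp_all add: on_line_const on_line_var on_line_add on_line_mult line_def del: One_nat_def)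

lemma on_line_eq_0_iff [simp]: "on_line p = 0 \<longleftrightarrow> p = 0"
  by (metis on_line_0 poly_0 poly_on_line_1)

lemma poly_pd_const: "poly_pd v (Poly_Mapping.single 0 c) = 0"
  by (simp add: poly_pd_single)

lemma poly_pd_diff: "poly_pd v (p - q) = poly_pd v p - poly_pd v q"
  by (metis diff_conv_add_uminus poly_pd_add poly_pd_uminus)

lemma poly_pd_sum: "poly_pd v (sum f A) = (\<Sum>a\<in>A. poly_pd v (f a))"
  by (induction A rule: infinite_finite_induct) (simp_all add: poly_pd_add)

lemma poly_pd_var:
  "poly_pd v (Poly_Mapping.single (Poly_Mapping.single w 1) 1) = of_bool (v = w)"
  by (simp add: poly_pd_single lookup_single when_def)

lemma map_poly_pd_add:
  "map_poly (poly_pd v) (p + q) = map_poly (poly_pd v) p + map_poly (poly_pd v) q"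
  by (intro poly_eqI) (simp add: coeff_map_poly poly_pd_add)

lemma map_poly_pd_mult:
  "map_poly (poly_pd v) (p * q) = map_poly (poly_pd v) p * q + p * map_poly (poly_pd v) q"
  by (intro poly_eqI)
    (simp add: coeff_map_poly coeff_mult poly_pd_sum poly_pd_mult sum.distrib)

text \<open>The chain rule along b + t(X - b): the inner derivative is t, which is the factor
  \<open>pCons 0\<close>. Hence a derivative moves homogeneous parts down by one degree.\<close>

lemma map_poly_pd_on_line:
  "map_poly (poly_pd v) (on_line p) = pCons 0 (on_line (poly_pd v p))"
proof (induction p rule: xypoly_induct)
  case (const c)
  show ?case by (simp add: on_line_const poly_pd_const map_poly_pCons)
next
  case (var w)
  show ?case
    by (simp add: on_line_var poly_pd_var line_def map_poly_pCons poly_pd_const poly_pd_diff of_bool_def flip: one_pCons del: One_nat_def)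
next
  case (add p q)
  then show ?case by (simp add: on_line_add poly_pd_add map_poly_pd_add)
next
  case (mult p q)
  then show ?case
    by (simp add: on_line_mult on_line_add poly_pd_mult map_poly_pd_mult)
qed

section \<open>Order of vanishing of polynomials\<close>

definition pord :: "'n::finite xypoly \<Rightarrow> nat"
  where "pord p = order 0 (on_line p)"

text \<open>A predicate instead of a value, so that 0 satisfies every bound. The bound is an integer
  because orders of fractions can be negative.\<close>

definition pge :: "int \<Rightarrow> 'n::finite xypoly \<Rightarrow> bool"
  where "pge n p \<longleftrightarrow> (\<forall>k. int k < n \<longrightarrow> coeff (on_line p) k = 0)"

lemma pge_iff: "p \<noteq> 0 \<Longrightarrow> pge n p \<longleftrightarrow> n \<le> int (pord p)"
proof -
  assume "p \<noteq> 0"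
  have "pge n p \<longleftrightarrow> monom 1 (nat n) dvd on_line p"
    by (auto simp: pge_def monom_1_dvd_iff' zless_nat_eq_int_zless)
  with \<open>p \<noteq> 0\<close> show ?thesis by (simp add: monom_1_dvd_iff pord_def nat_le_iff)
qed

lemma pge_0 [simp]: "pge n 0"
  by (simp add: pge_def)

lemma pge_add: "pge n p \<Longrightarrow> pge n q \<Longrightarrow> pge n (p + q)"
  by (simp add: pge_def on_line_add)

lemma pord_mult: "p \<noteq> 0 \<Longrightarrow> q \<noteq> 0 \<Longrightarrow> pord (p * q) = pord p + pord q"
  by (simp add: pord_def on_line_mult order_mult)

lemma pge_mult: "pge m p \<Longrightarrow> pge n q \<Longrightarrow> pge (m + n) (p * q)"
  by (cases "p = 0 \<or> q = 0") (auto simp: pge_iff pord_mult)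

lemma pge_pd: 
  assumes "pge n p" shows "pge (n - 1) (poly_pd v p)"
  unfolding pge_def
proof (intro allI impI)
  fix k assume k: "int k < n - 1"
  have "coeff (on_line (poly_pd v p)) k = coeff (map_poly (poly_pd v) (on_line p)) (Suc k)"
    by (simp add: map_poly_pd_on_line)
  also have "\<dots> = 0" using assms k by (simp add: coeff_map_poly pge_def)
  finally show "coeff (on_line (poly_pd v p)) k = 0" .
qed

section \<open>The valuation on rational functions\<close>

definition vge :: "int \<Rightarrow> 'n::finite ratfun \<Rightarrow> bool"
  where "vge n f \<longleftrightarrow> (\<exists>a b. b \<noteq> 0 \<and> f = Fract a b \<and> pge (n + int (pord b)) a)"

lemma vgeE:
  assumes "vge n f"
  obtains a b where "b \<noteq> 0" "f = Fract a b" "pge (n + int (pord b)) a"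
  using assms by (auto simp: vge_def)

lemma pge_mono: "pge n p \<Longrightarrow> m \<le> n \<Longrightarrow> pge m p"
  by (auto simp: pge_def)

lemma vge_mono: "vge n f \<Longrightarrow> m \<le> n \<Longrightarrow> vge m f"
  by (fastforce simp: vge_def intro: pge_mono)

lemma pge_uminus: "pge n p \<Longrightarrow> pge n (- p)"
proof -
  have "on_line (- p) = - on_line p"
    using on_line_add [of p "- p"] by (simp add: eq_neg_iff_add_eq_0 add.commute)
  then show "pge n p \<Longrightarrow> pge n (- p)" by (simp add: pge_def)
qed

lemma vge_add:
  fixes f :: "'n::finite ratfun"
  shows "vge n f \<Longrightarrow> vge n g \<Longrightarrow> vge n (f + g)"
proof (elim vgeE)
  fix a b c d :: "'n xypoly"
  assume *: "b \<noteq> 0" "f = Fract a b" "pge (n + int (pord b)) a"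
     "d \<noteq> 0" "g = Fract c d" "pge (n + int (pord d)) c"
  have "pge (n + int (pord (b * d))) (a * d + c * b)"
  proof (rule pge_add)
    have "pge (int (pord d)) d" using * by (simp add: pge_iff)
    from pge_mult [OF *(3) this] show "pge (n + int (pord (b * d))) (a * d)"
      using * by (simp add: pord_mult ac_simps)
    have "pge (int (pord b)) b" using * by (simp add: pge_iff)
    from pge_mult [OF *(6) this] show "pge (n + int (pord (b * d))) (c * b)"
      using * by (simp add: pord_mult ac_simps)
  qed
  moreover have "f + g = Fract (a * d + c * b) (b * d)" using * by simp
  ultimately show ?thesis using * unfolding vge_def by (metis mult_eq_0_iff)
qed

lemma vge_uminus: "vge n f \<Longrightarrow> vge n (- f)"
  unfolding vge_def by (metis minus_fract pge_uminus)

lemma vge_diff: "vge n f \<Longrightarrow> vge n g \<Longrightarrow> vge n (f - g)"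
  using vge_add [of n f "- g"] vge_uminus [of n g] by simp

lemma vge_mult:
  fixes f :: "'n::finite ratfun"
  shows "vge m f \<Longrightarrow> vge n g \<Longrightarrow> vge (m + n) (f * g)"
proof (elim vgeE)
  fix a b c d :: "'n xypoly"
  assume *: "b \<noteq> 0" "f = Fract a b" "pge (m + int (pord b)) a"
     "d \<noteq> 0" "g = Fract c d" "pge (n + int (pord d)) c"
  have "pge (m + n + int (pord (b * d))) (a * c)"
    using pge_mult [OF *(3,6)] * by (simp add: pord_mult ac_simps)
  moreover have "f * g = Fract (a * c) (b * d)" using * by simp
  ultimately show ?thesis using * unfolding vge_def by (metis mult_eq_0_iff)
qed

text \<open>By the quotient rule each term of the numerator has order at least
  \<open>n - 1 + 2 * pord b\<close>, and the denominator \<open>b * b\<close> takes away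
  \<open>2 * pord b\<close>.\<close>

lemma vge_pd:
  fixes f :: "'n::finite ratfun"
  shows "vge n f \<Longrightarrow> vge (n - 1) (pd v f)"
proof (elim vgeE)
  fix a b :: "'n xypoly"
  assume *: "b \<noteq> 0" "f = Fract a b" "pge (n + int (pord b)) a"
  have b: "pge (int (pord b)) b" using * by (simp add: pge_iff)
  have "pge (n - 1 + int (pord (b * b))) (poly_pd v a * b + - (a * poly_pd v b))"
    using pge_mult [OF pge_pd [OF *(3), of v] b] pge_mult [OF *(3) pge_pd [OF b, of v]] *
    by (intro pge_add pge_uminus) (simp_all add: pord_mult algebra_simps)
  moreover have "pd v f = Fract (poly_pd v a * b + - (a * poly_pd v b)) (b * b)"
    using * by (simp add: pd_Fract)
  ultimately show ?thesis using * unfolding vge_def by (metis mult_eq_0_iff)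
qed

lemma vge_0 [simp]: "vge n 0"
  unfolding vge_def Zero_fract_def by (intro exI [of _ 0] exI [of _ 1]) simp

lemma vge_sum: "(\<And>a. a \<in> A \<Longrightarrow> vge n (f a)) \<Longrightarrow> vge n (sum f A)"
  by (induction A rule: infinite_finite_induct) (simp_all add: vge_add)

text \<open>Cross-multiplication shows that \<open>pord a - pord b\<close> is the same for every
  fraction representing \<open>f\<close>. Having an exact finite order is what allows a term of
  minimal order to be chosen.\<close>

lemma vge_exact:
  assumes "f \<noteq> 0" shows "\<exists>v. \<forall>n. vge n f \<longleftrightarrow> n \<le> v"
proof -
  obtain a b where f: "f = Fract a b" "b \<noteq> 0" by (rule Fract_cases)
  with assms have a: "a \<noteq> 0" by (auto simp: Zero_fract_def [symmetric] fract_collapse)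
  have "vge n f \<longleftrightarrow> n \<le> int (pord a) - int (pord b)" for n
  proof
    assume "vge n f"
    then obtain c d where d: "d \<noteq> 0" "f = Fract c d" "pge (n + int (pord d)) c"
      by (rule vgeE)
    with assms have c: "c \<noteq> 0" by (auto simp: fract_collapse)
    have "a * d = c * b" using f d by (simp add: eq_fract)
    then have "pord a + pord d = pord c + pord b" using a c d f by (metis pord_mult)
    then show "n \<le> int (pord a) - int (pord b)" using d c by (simp add: pge_iff)
  next
    assume "n \<le> int (pord a) - int (pord b)"
    then show "vge n f" unfolding vge_def using f a
      by (intro exI [of _ a] exI [of _ b]) (simp add: pge_iff)
  qed
  then show ?thesis by blast
qed

lemma vge_lower: "\<exists>v. vge v f"
  using vge_exact [of f] by (cases "f = 0") auto

text \<open>Modulo the maximal ideal at the base point, \<open>M\<close> is the identity matrix, so a vector of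
  exact order \<open>v\<close> is mapped to a vector of exact order \<open>v\<close>.\<close>

lemma near_identity_vge:
  fixes a :: "'a \<Rightarrow> 'n::finite ratfun"
  assumes fin: "finite A"
    and nz: "a s0 \<noteq> 0" "s0 \<in> A"
  obtains N where "\<And>M. (\<And>s t. s \<in> A \<Longrightarrow> t \<in> A \<Longrightarrow> vge 1 (M s t - of_bool (s = t))) \<Longrightarrow>
      \<exists>t\<in>A. \<not> vge N (\<Sum>s\<in>A. a s * M s t)"
proof -
  let ?B = "{s \<in> A. a s \<noteq> 0}"
  have "\<forall>s\<in>?B. \<exists>v. \<forall>n. vge n (a s) \<longleftrightarrow> n \<le> v" using vge_exact by blast
  then obtain val where val: "\<And>s n. s \<in> ?B \<Longrightarrow> vge n (a s) \<longleftrightarrow> n \<le> val s" by metis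
  define t where "t = arg_min_on val ?B"
  have t: "t \<in> ?B" "\<And>s. s \<in> ?B \<Longrightarrow> val t \<le> val s"
    using arg_min_least [of ?B] arg_min_if_finite(1) [of ?B] fin nz unfolding t_def by auto
  show ?thesis
  \<comment> \<open>The bound \<open>val t + 1\<close> depends on \<open>a\<close> only. An
    application can therefore fix it first and choose \<open>M\<close> afterwards.\<close>
  proof (rule that [of "val t + 1"], rule bexI [of _ t], rule notI)
    fix M :: "'a \<Rightarrow> 'a \<Rightarrow> 'n ratfun"
    assume M: "\<And>s t. s \<in> A \<Longrightarrow> t \<in> A \<Longrightarrow> vge 1 (M s t - of_bool (s = t))"
    assume *: "vge (val t + 1) (\<Sum>s\<in>A. a s * M s t)"
    \<comment> \<open>\<open>val t\<close> is minimal and the second factor has order at least 1. So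
      replacing \<open>M\<close> by the identity changes the sum only in orders beyond
      \<open>val t\<close>, and then \<open>a t\<close> alone remains.\<close>
    have "vge (val t + 1) (a s * (M s t - of_bool (s = t)))" if "s \<in> A" for s
    proof (cases "s \<in> ?B")
      case True
      then show ?thesis using val t M that by (intro vge_mult) auto
    qed (use that in auto)
    then have "vge (val t + 1) (\<Sum>s\<in>A. a s * (M s t - of_bool (s = t)))"
      by (rule vge_sum)
    from vge_diff [OF * this] have "vge (val t + 1) (\<Sum>s\<in>A. a s * of_bool (s = t))"
      by (simp add: right_diff_distrib flip: sum_subtractf)
    moreover have "(\<Sum>s\<in>A. a s * of_bool (s = t)) = a t"
      using t fin by (simp add: of_bool_def if_distrib cong: if_cong)
    ultimately show False using val t by auto
  qed (use t in auto)
qed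

section \<open>Truncated power series at the base point\<close>

lemma pd_0 [simp]: "pd v 0 = 0"
  by (metis add_cancel_right_right pd_add)

lemma pd_uminus: "pd v (- f) = - pd v f"
  by (metis add_eq_0_iff pd_0 pd_add)

lemma pd_diff: "pd v (f - g) = pd v f - pd v g"
  by (metis diff_conv_add_uminus pd_add pd_uminus)

lemma pd_1 [simp]: "pd v 1 = 0"
  by (metis add_cancel_right_left mult.right_neutral mult_1 pd_mult)

lemma pd_sum: "pd v (sum f A) = (\<Sum>a\<in>A. pd v (f a))"
  by (induction A rule: infinite_finite_induct) (simp_all add: pd_add)

lemma pd_power: "pd v (f ^ k) = of_nat k * f ^ (k - 1) * pd v f"
proof (induction k)
  case (Suc k)
  then show ?case by (cases k) (simp_all add: pd_mult algebra_simps)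
qed simp

lemma poly_pd_1 [simp]: "poly_pd v 1 = 0"
  using poly_pd_const [of v 1] by simp

lemma pd_poly: "pd v (Fract a 1) = Fract (poly_pd v a) 1"
  by (simp add: pd_Fract)

lemma poly_pd_commute: "poly_pd u (poly_pd v p) = poly_pd v (poly_pd u p)"
  by (rule poly_mapping_eqI)
    (simp add: poly_pd.rep_eq lookup_add lookup_single when_def ac_simps)

text \<open>The commutator of two derivations is again a derivation. It vanishes on polynomials,
  hence on \<open>f\<close>, whose product with its nonzero denominator is a polynomial.\<close>

lemma pd_commute: "pd u (pd v f) = pd v (pd u f)"
proof -
  obtain a b where f: "f = Fract a b" "b \<noteq> 0" by (rule Fract_cases)
  have fb: "f * Fract b 1 = Fract a 1" using f by (simp add: eq_fract)
  let ?D = "\<lambda>f. pd u (pd v f) - pd v (pd u f)"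
  have D: "?D (g * h) = ?D g * h + g * ?D h" for g h
    by (simp add: pd_mult pd_add algebra_simps)
  have poly: "?D (Fract c 1) = 0" for c
    by (simp add: pd_poly poly_pd_commute [of u v])
  have "?D f * Fract b 1 = 0" using D [of f "Fract b 1"] unfolding poly fb by simp
  moreover have "Fract b 1 \<noteq> 0" using f by (simp add: Zero_fract_def eq_fract)
  ultimately show ?thesis by simp
qed

section \<open>Constants and coordinates centred at the base point\<close>

definition kconst :: "complex \<Rightarrow> 'n::finite ratfun"
  where "kconst c = Fract (Poly_Mapping.single 0 c) 1"

lemma kconst_0 [simp]: "kconst 0 = 0"
  and kconst_1 [simp]: "kconst 1 = 1"
  by (simp_all add: kconst_def fract_collapse)

lemma kconst_add: "kconst (a + b) = kconst a + kconst b"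
  by (simp add: kconst_def single_add)

lemma kconst_mult: "kconst (a * b) = kconst a * kconst b"
  by (simp add: kconst_def mult_single)

lemma kconst_of_nat [simp]: "kconst (of_nat k) = of_nat k"
  by (induction k) (simp_all add: kconst_add)

lemma kconst_numeral [simp]: "kconst (numeral k) = numeral k"
  using kconst_of_nat [of "numeral k"] by simp

lemma pd_kconst [simp]: "pd v (kconst c) = 0"
  by (simp add: kconst_def pd_poly poly_pd_const fract_collapse)

lemma pd_ratvar: "pd v (ratvar w) = of_bool (v = w)"
  unfolding ratvar_def pd_poly poly_pd_var by (simp add: fract_collapse of_bool_def)

definition zvar :: "'n::finite xyvar \<Rightarrow> 'n ratfun"
  where "zvar v = ratvar v - kconst (basept v)"

lemma pd_zvar: "pd v (zvar w) = of_bool (v = w)"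
  by (simp add: zvar_def pd_diff pd_ratvar)

lemma pord_1 [simp]: "pord 1 = 0"
  by (simp add: pord_def)

lemma vge_poly: "pge n a \<Longrightarrow> vge n (Fract a 1)"
  unfolding vge_def by (intro exI [of _ a] exI [of _ 1]) simp

lemma vge_kconst: "vge 0 (kconst c)"
  unfolding kconst_def by (intro vge_poly) (simp add: pge_def)

lemma vge_zvar: "vge 1 (zvar v)"
proof -
  have "zvar v = Fract (Poly_Mapping.single (Poly_Mapping.single v 1) 1 +
      Poly_Mapping.single 0 (- basept v)) 1"
    unfolding zvar_def ratvar_def kconst_def by (simp add: single_uminus)
  moreover have "pge 1 (Poly_Mapping.single (Poly_Mapping.single v 1) 1 +
      Poly_Mapping.single 0 (- basept v))"
    unfolding pge_def on_line_add on_line_var on_line_const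
    by (auto simp: line_def single_uminus)
  ultimately show ?thesis by (simp only: vge_poly)
qed

lemma vge_1: "vge 0 1"
  using vge_kconst [of 1] by simp

lemma vge_power: "vge 1 f \<Longrightarrow> vge (int k) (f ^ k)"
proof (induction k)
  case (Suc k)
  then show ?case using vge_mult [of 1 f "int k" "f ^ k"] by (simp add: ac_simps)
qed (simp add: vge_1)

lemma vge_prod: "(\<And>a. a \<in> A \<Longrightarrow> vge (n a) (f a)) \<Longrightarrow> vge (sum n A) (prod f A)"
  by (induction A rule: infinite_finite_induct) (simp_all add: vge_1 vge_mult)

section \<open>Monomials and truncated power series in the centred coordinates\<close>

definition zmonom :: "('n::finite xyvar \<Rightarrow> nat) \<Rightarrow> 'n ratfun"
  where "zmonom m = (\<Prod>v\<in>UNIV. zvar v ^ m v)"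

definition incr :: "'a \<Rightarrow> ('a \<Rightarrow> nat) \<Rightarrow> 'a \<Rightarrow> nat"
  where "incr v m = m(v := Suc (m v))"

lemma incr_apply: "incr v m w = (if w = v then Suc (m v) else m w)"
  by (simp add: incr_def)

lemma incr_commute: "incr v (incr w m) = incr w (incr v m)"
  by (auto simp: incr_apply fun_eq_iff)

lemma sum_incr:
  fixes v :: "'a::finite"
  shows "(\<Sum>w\<in>UNIV. f w (incr v m w)) = f v (Suc (m v)) + (\<Sum>w\<in>UNIV - {v}. f w (m w))"
  by (subst sum.remove [of UNIV v]) (auto simp: incr_apply intro!: sum.cong)

lemma prod_incr:
  fixes v :: "'a::finite"
  shows "(\<Prod>w\<in>UNIV. f w (incr v m w)) = f v (Suc (m v)) * (\<Prod>w\<in>UNIV - {v}. f w (m w))"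
  by (subst prod.remove [of UNIV v]) (auto simp: incr_apply intro!: prod.cong)

lemma vge_zmonom: "vge (int (sum m UNIV)) (zmonom m)"
  unfolding zmonom_def of_nat_sum by (intro vge_prod vge_power vge_zvar)

lemma zmonom_remove: "zmonom m = zvar v ^ m v * (\<Prod>w\<in>UNIV - {v}. zvar w ^ m w)"
  unfolding zmonom_def by (rule prod.remove) auto

lemma zmonom_upd: "zmonom (m(v := k)) = zvar v ^ k * (\<Prod>w\<in>UNIV - {v}. zvar w ^ m w)"
  unfolding zmonom_remove [of _ v] by simp

lemma pd_prod_0: "(\<And>a. a \<in> A \<Longrightarrow> pd v (f a) = 0) \<Longrightarrow> pd v (prod f A) = 0"
  by (induction A rule: infinite_finite_induct) (simp_all add: pd_mult)

lemma pd_zmonom: "pd v (zmonom m) = of_nat (m v) * zmonom (m(v := m v - 1))"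
proof -
  have "pd v (\<Prod>w\<in>UNIV - {v}. zvar w ^ m w) = 0"
    by (rule pd_prod_0) (simp add: pd_power pd_zvar)
  then show ?thesis
    unfolding zmonom_upd zmonom_remove [of m v] by (simp add: pd_mult pd_power pd_zvar)
qed

lemma zvar_pd_zmonom: "zvar v * pd v (zmonom m) = of_nat (m v) * zmonom m"
proof (cases "m v")
  case (Suc k)
  have "zvar v * zmonom (m(v := k)) = zmonom m"
    unfolding zmonom_upd zmonom_remove [of m v] Suc by simp
  with Suc show ?thesis by (simp add: pd_zmonom mult.left_commute)
qed (simp add: pd_zmonom)

lemma sum_incr_Suc: "sum (incr v m) (UNIV :: 'a::finite set) = Suc (sum m UNIV)"
  using sum_incr [of "\<lambda>w k. k" v m] by (simp add: sum.remove [of UNIV v m])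

definition mfact :: "('a::finite \<Rightarrow> nat) \<Rightarrow> complex"
  where "mfact m = (\<Prod>v\<in>UNIV. fact (m v))"

lemma mfact_incr: "mfact (incr v m) = of_nat (Suc (m v)) * mfact m"
  using prod_incr [of "\<lambda>w k. fact k" v m]
  by (simp add: mfact_def prod.remove [of UNIV v "\<lambda>w. fact (m w)"] mult.assoc)

text \<open>Up to degree \<open>n\<close>, \<open>e m\<close> is the value at the base point of the
  derivative with exponents \<open>m\<close>; dividing by \<open>mfact m\<close> turns
  differentiation into an index shift. Truncation keeps the sum a rational function.\<close>

definition series :: "(('n::finite xyvar \<Rightarrow> nat) \<Rightarrow> complex) \<Rightarrow> nat \<Rightarrow> 'n ratfun"
  where "series e n = (\<Sum>m | sum m UNIV \<le> n. kconst (e m / mfact m) * zmonom m)"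

lemma finite_degree_le: "finite {m :: 'a::finite \<Rightarrow> nat. sum m UNIV \<le> n}"
proof (rule finite_subset)
  show "{m :: 'a \<Rightarrow> nat. sum m UNIV \<le> n} \<subseteq> Pi\<^sub>E UNIV (\<lambda>_. {..n})"
  proof (rule subsetI)
    fix m :: "'a \<Rightarrow> nat"
    assume "m \<in> {m. sum m UNIV \<le> n}"
    moreover have "m v \<le> sum m UNIV" for v by (rule member_le_sum) auto
    ultimately show "m \<in> Pi\<^sub>E UNIV (\<lambda>_. {..n})" by (auto intro: order_trans)
  qed
  show "finite (Pi\<^sub>E (UNIV :: 'a set) (\<lambda>_. {..n}))"
    by (rule finite_PiE) auto
qed

lemma pd_series: "pd v (series e (Suc n)) = series (\<lambda>m. e (incr v m)) n"
proof -
  let ?t = "\<lambda>m. kconst (e m / mfact m) * (of_nat (m v) * zmonom (m(v := m v - 1)))"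
  have "pd v (series e (Suc n)) = (\<Sum>m | sum m UNIV \<le> Suc n. ?t m)"
    by (simp add: series_def pd_sum pd_mult pd_zmonom)
  also have "\<dots> = (\<Sum>m | sum m UNIV \<le> n. ?t (incr v m))"
  proof -
    have inj: "inj (incr v)"
      by (rule injI) (auto simp: incr_apply fun_eq_iff split: if_splits)
    \<comment> \<open>Monomials free of \<open>v\<close> are killed; the remaining exponents are
      exactly the successors in \<open>v\<close> of exponents of degree at most
      \<open>n\<close>.\<close>
    have img: "incr v ` {m. sum m UNIV \<le> n} = {m. sum m UNIV \<le> Suc n \<and> m v \<noteq> 0}"
    proof (intro equalityI subsetI)
      fix m :: "'a xyvar \<Rightarrow> nat"
      assume m: "m \<in> {m. sum m UNIV \<le> Suc n \<and> m v \<noteq> 0}"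
      then have eq: "m = incr v (m(v := m v - 1))" by (auto simp: incr_def)
      then have "sum m UNIV = Suc (sum (m(v := m v - 1)) UNIV)"
        by (metis sum_incr_Suc)
      then have "sum (m(v := m v - 1)) UNIV \<le> n" using m by simp
      then have "m(v := m v - 1) \<in> {m. sum m UNIV \<le> n}" by (simp only: mem_Collect_eq)
      then show "m \<in> incr v ` {m. sum m UNIV \<le> n}" by (rule image_eqI [where f = "incr v", OF eq])
    qed (auto simp: sum_incr_Suc, simp add: incr_apply)
    have "(\<Sum>m | sum m UNIV \<le> Suc n. ?t m) = (\<Sum>m | sum m UNIV \<le> Suc n \<and> m v \<noteq> 0. ?t m)"
      by (rule sum.mono_neutral_right [OF finite_degree_le]) auto
    also have "\<dots> = (\<Sum>m | sum m UNIV \<le> n. ?t (incr v m))"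
      unfolding img [symmetric] using sum.reindex [OF inj_on_subset [OF inj], of _ ?t] by simp
    finally show ?thesis .
  qed
  also have "\<dots> = (\<Sum>m | sum m UNIV \<le> n. kconst (e (incr v m) / mfact m) * zmonom m)"
  proof (rule sum.cong [OF refl])
    fix m :: "'a xyvar \<Rightarrow> nat"
    have *: "e (incr v m) / mfact m = e (incr v m) / mfact (incr v m) * of_nat (Suc (m v))"
      unfolding mfact_incr by (simp add: field_simps del: of_nat_Suc)
    show "?t (incr v m) = kconst (e (incr v m) / mfact m) * zmonom m"
      unfolding * kconst_mult kconst_of_nat by (simp add: incr_def del: of_nat_Suc)
  qed
  finally show ?thesis by (simp add: series_def)
qed

text \<open>Monomials are eigenvectors of this Euler operator, so it only rescales coefficients and,
  unlike \<open>pd v\<close> alone, keeps the truncation degree.\<close>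

lemma zvar_pd_series: "zvar v * pd v (series e n) = series (\<lambda>m. of_nat (m v) * e m) n"
proof -
  have "zvar v * pd v (series e n) =
      (\<Sum>m | sum m UNIV \<le> n. kconst (e m / mfact m) * (zvar v * pd v (zmonom m)))"
    by (simp add: series_def pd_sum pd_mult sum_distrib_left mult.left_commute)
  also have "\<dots> = series (\<lambda>m. of_nat (m v) * e m) n"
    unfolding series_def zvar_pd_zmonom
    by (intro sum.cong refl) (simp add: kconst_mult flip: times_divide_eq_right)
  finally show ?thesis .
qed

lemma series_add: "series (\<lambda>m. e m + e' m) n = series e n + series e' n"
  by (simp add: series_def add_divide_distrib kconst_add distrib_right sum.distrib)

lemma series_cmult: "series (\<lambda>m. c * e m) n = kconst c * series e n"
  by (simp add: series_def sum_distrib_left kconst_mult mult.assoc flip: times_divide_eq_right)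

lemma series_0 [simp]: "series (\<lambda>_. 0) n = 0"
  by (simp add: series_def)

lemma series_sum: "series (\<lambda>m. \<Sum>a\<in>A. e a m) n = (\<Sum>a\<in>A. series (e a) n)"
  by (induction A rule: infinite_finite_induct) (simp_all add: series_add)

text \<open>Only monomials of degree above \<open>n\<close> survive in the difference. Truncation
  degrees can thus be adjusted at the cost of terms of high order.\<close>

lemma vge_series_diff:
  fixes e :: "('n::finite xyvar \<Rightarrow> nat) \<Rightarrow> complex"
  assumes "n \<le> n'"
  shows "vge (int n + 1) (series e n' - series e n)"
proof -
  have "series e n' - series e n =
      (\<Sum>m \<in> {m. sum m UNIV \<le> n'} - {m. sum m UNIV \<le> n}. kconst (e m / mfact m) * zmonom m)"
    unfolding series_def using assms by (intro sum_diff [symmetric] finite_degree_le) auto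
  moreover have "vge (int n + 1) (kconst (e m / mfact m) * zmonom m)"
    if "sum m UNIV > n" for m :: "'n xyvar \<Rightarrow> nat"
    using vge_mult [OF vge_kconst vge_zmonom [of m]] that
    by (rule_tac vge_mono) (auto simp del: of_nat_sum)
  ultimately show ?thesis
    by (metis (no_types, lifting) DiffE linorder_not_le mem_Collect_eq vge_sum)
qed

lemma series_order_0: "series e 0 = kconst (e (\<lambda>_. 0))"
proof -
  have "{m :: 'a xyvar \<Rightarrow> nat. sum m UNIV \<le> 0} = {\<lambda>_. 0}" by (auto simp: fun_eq_iff)
  then show ?thesis by (simp add: series_def mfact_def zmonom_def)
qed

text \<open>Multisets of indices serve as exponents of monomials in the y-derivatives; the fold is
  well defined because derivatives commute.\<close>

definition dys :: "'n::finite multiset \<Rightarrow> 'n ratfun \<Rightarrow> 'n ratfun"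
  where "dys M f = fold_mset dy f M"

lemma dys_empty [simp]: "dys {#} f = f"
  by (simp add: dys_def)

lemma dys_add_mset [simp]: "dys (add_mset i M) f = dy i (dys M f)"
proof -
  interpret comp_fun_commute "dy :: 'a \<Rightarrow> _"
    by standard (auto simp: pd_commute)
  show ?thesis by (simp add: dys_def)
qed

definition shift_y :: "'n multiset \<Rightarrow> ('n xyvar \<Rightarrow> nat) \<Rightarrow> 'n xyvar \<Rightarrow> nat"
  where "shift_y M m v = m v + (case v of XVar u \<Rightarrow> 0 | YVar k \<Rightarrow> count M k)"

lemma dys_series: "dys M (series e (n + size M)) = series (\<lambda>m. e (shift_y M m)) n"
proof (induction M arbitrary: n)
  case empty
  have "shift_y {#} m = m" for m :: "'a xyvar \<Rightarrow> nat"
    by (auto simp: shift_y_def fun_eq_iff split: xyvar.split)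
  then show ?case by simp
next
  case (add k M)
  have "shift_y M (incr (YVar k) m) = shift_y (add_mset k M) m" for m
    by (auto simp: shift_y_def incr_apply fun_eq_iff split: xyvar.split)
  then show ?case using add [of "Suc n"] by (simp add: pd_series)
qed

section \<open>The formal solutions of the system\<close>

text \<open>Taylor coefficients at \<open>0\<close> of the even and odd solutions of \<open>h'' + y h' + h = 0\<close>, which is the
  first family of equations for \<open>d = 1\<close> and \<open>x = 1/2\<close>.\<close>

fun hcoeff :: "bool \<Rightarrow> nat \<Rightarrow> complex"
  where "hcoeff b 0 = of_bool (\<not> b)"
  | "hcoeff b (Suc 0) = of_bool b"
  | "hcoeff b (Suc (Suc k)) = - of_nat (Suc k) * hcoeff b k"

text \<open>On solutions \<open>\<partial>\<^sub>v\<close> acts as \<open>xscale v\<close> times the monomial in the \<open>\<partial>\<^sub>y\<close> with exponents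
  \<open>weight i v\<close>; the same weights turn the \<open>x\<close> and \<open>y\<close> terms of the first family of generators into
  an Euler operator in the shifted variables plus \<open>\<partial>\<^sub>y\<^sub>i\<^sup>2\<close>.\<close>

fun weight :: "'n \<Rightarrow> 'n xyvar \<Rightarrow> nat"
  where "weight i (XVar u) = (if u = Upair i i then 2 else of_bool (i \<in> set_uprod u))"
  | "weight i (YVar k) = of_bool (i = k)"

fun xscale :: "'n xyvar \<Rightarrow> complex"
  where "xscale (XVar u) = (if \<exists>i. u = Upair i i then 1 else 2)"
  | "xscale (YVar k) = 1"

definition mweight :: "('n::finite xyvar \<Rightarrow> nat) \<Rightarrow> 'n \<Rightarrow> nat"
  where "mweight m i = (\<Sum>v\<in>UNIV. weight i v * m v)"

definition hprod :: "'n::finite set \<Rightarrow> ('n \<Rightarrow> nat) \<Rightarrow> complex"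
  where "hprod T \<alpha> = (\<Prod>i\<in>UNIV. hcoeff (i \<in> T) (\<alpha> i))"

text \<open>The Taylor coefficients of the solution belonging to \<open>T\<close>. The x-equations
  turn the derivative with exponents \<open>m\<close> into a y-derivative with exponents
  \<open>mweight m\<close>; at the base value of x the solution is a product of one-variable
  solutions, odd in the indices from \<open>T\<close> and even in the others.\<close>

definition sol :: "'n::finite set \<Rightarrow> ('n xyvar \<Rightarrow> nat) \<Rightarrow> complex"
  where "sol T m = (\<Prod>v\<in>UNIV. xscale v ^ m v) * hprod T (mweight m)"

lemma mweight_incr: "mweight (incr v m) i = mweight m i + weight i v"
  using sum_incr [of "\<lambda>w k. weight i w * k" v m]
  by (simp add: mweight_def sum.remove [of UNIV v "\<lambda>w. weight i w * m w"])

lemma xscale_incr: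
  fixes v :: "'n::finite xyvar"
  shows "(\<Prod>w\<in>UNIV. xscale w ^ incr v m w) = xscale v * (\<Prod>w\<in>UNIV. xscale w ^ m w)"
  using prod_incr [of "\<lambda>w k. xscale w ^ k" v m]
  by (simp add: prod.remove [of UNIV v "\<lambda>w. xscale w ^ m w"] mult.assoc)

text \<open>\<open>XVar (Upair i j)\<close> carries the weights of \<open>YVar i\<close> and
  \<open>YVar j\<close> together, and \<open>xscale\<close> supplies the factor. This is the
  coefficient form of the x-equations.\<close>

lemma sol_incr_x:
  "sol T (incr (XVar (Upair i j)) m) =
    (if i = j then 1 else 2) * sol T (incr (YVar i) (incr (YVar j) m))"
proof -
  have "mweight (incr (XVar (Upair i j)) m) = mweight (incr (YVar i) (incr (YVar j) m))"
    by (auto simp: fun_eq_iff mweight_incr)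
  then show ?thesis by (simp add: sol_def xscale_incr)
qed

text \<open>Two steps in \<open>YVar i\<close> raise \<open>mweight m i\<close> by 2 and leave the
  other weights alone, so the recursion of \<open>hcoeff\<close> applies in the factor of
  \<open>i\<close>.\<close>

lemma sol_incr_y:
  "sol T (incr (YVar i) (incr (YVar i) m)) = - (of_nat (mweight m i) + 1) * sol T m"
proof -
  have "hprod T (mweight (incr (YVar i) (incr (YVar i) m))) =
     - (of_nat (mweight m i) + 1) * hprod T (mweight m)"
    unfolding hprod_def
    by (simp add: prod.remove [of UNIV i] mweight_incr algebra_simps)
  then show ?thesis by (simp add: sol_def xscale_incr)
qed

text \<open>A squarefree monomial has weights 0 and 1, the two places where \<open>hcoeff\<close>
  takes its initial values.\<close>

lemma sol_shift_y: "sol T (shift_y (mset_set S) (\<lambda>_. 0)) = of_bool (S = T)"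
proof -
  have "mweight (shift_y (mset_set S) (\<lambda>_. 0)) i = of_bool (i \<in> S)" for i
  proof -
    have "mweight (shift_y (mset_set S) (\<lambda>_. 0)) i =
       (\<Sum>v\<in>UNIV. if v = YVar i then of_bool (i \<in> S) else 0)"
      unfolding mweight_def by (rule sum.cong) (auto simp: shift_y_def split: xyvar.split)
    then show ?thesis by simp
  qed
  moreover have "hcoeff (i \<in> T) (of_bool (i \<in> S)) = of_bool (i \<in> S \<longleftrightarrow> i \<in> T)" for i
    by auto
  moreover have "(\<Prod>v\<in>UNIV. xscale v ^ shift_y (mset_set S) (\<lambda>_. 0) v) = 1"
    by (rule prod.neutral) (auto simp: shift_y_def split: xyvar.split)
  ultimately have "sol T (shift_y (mset_set S) (\<lambda>_. 0)) = (\<Prod>i\<in>UNIV. of_bool (i \<in> S \<longleftrightarrow> i \<in> T))"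
    by (simp add: sol_def hprod_def)
  also have "\<dots> = of_bool (S = T)"
    by (auto simp: set_eq_iff)
  finally show ?thesis .
qed

text \<open>Provides the near-identity matrix for the independence proof: all but the constant term
  of the differentiated series has order at least 1.\<close>

lemma dys_sol:
  assumes "card S \<le> n"
  shows "vge 1 (dys (mset_set S) (series (sol T) n) - of_bool (S = T))"
proof -
  let ?e = "\<lambda>m. sol T (shift_y (mset_set S) m)"
  have "dys (mset_set S) (series (sol T) n) = series ?e (n - card S)"
    using dys_series [of "mset_set S" "sol T" "n - card S"] assms by simp
  moreover have "series ?e 0 = of_bool (S = T)"
    by (simp add: series_order_0 sol_shift_y of_bool_def)
  ultimately show ?thesis
    using vge_series_diff [of 0 "n - card S" ?e] by simp
qed

text \<open>The coefficients agree exactly, but \<open>dx i j\<close> lowers the truncation degree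
  by 1 and the two y-derivatives lower it by 2; only this gap remains.\<close>

lemma sol_x_eq:
  assumes "c = (if i = j then 1 else 2)"
  shows "vge (int n + 1) (dx i j (series (sol T) (Suc (Suc n))) -
     c * dy i (dy j (series (sol T) (Suc (Suc n)))))"
proof -
  let ?e = "\<lambda>m. sol T (incr (YVar i) (incr (YVar j) m))"
  have c: "c = kconst (if i = j then 1 else 2)" using assms by simp
  have "dx i j (series (sol T) (Suc (Suc n))) - c * dy i (dy j (series (sol T) (Suc (Suc n)))) =
      c * (series ?e (Suc n) - series ?e n)"
    by (simp add: pd_series sol_incr_x series_cmult right_diff_distrib c incr_commute [of "YVar j"])
  moreover have "vge (int n + 1) (series ?e (Suc n) - series ?e n)"
    by (rule vge_series_diff) simp
  ultimately show ?thesis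
    using vge_mult [OF vge_kconst] by (metis add_0 c)
qed

text \<open>The variables of nonzero weight for \<open>i\<close> are \<open>YVar i\<close> and the
  \<open>XVar (Upair i k)\<close>, each met once as \<open>k\<close> varies.\<close>

lemma mweight_eq:
  "mweight m i = (\<Sum>k\<in>UNIV. weight i (XVar (Upair i k)) * m (XVar (Upair i k))) + m (YVar i)"
proof -
  let ?f = "\<lambda>v. weight i v * m v"
  have inj: "inj (\<lambda>k. XVar (Upair i k))" by (auto simp: inj_def)
  let ?X = "range (\<lambda>k. XVar (Upair i k))"
  have "mweight m i = sum ?f (insert (YVar i) ?X)"
    unfolding mweight_def
  proof (rule sum.mono_neutral_right)
    have "weight i v = 0" if "v \<notin> insert (YVar i) ?X" for v
    proof (cases v)
      case (XVar u)
      have "i \<notin> set_uprod u"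
      proof
        assume "i \<in> set_uprod u"
        then obtain k where "u = Upair i k" by (cases u) (auto simp: insert_commute)
        with that XVar show False by auto
      qed
      then show ?thesis using XVar by auto
    qed (use that in auto)
    then show "\<forall>v\<in>UNIV - insert (YVar i) ?X. ?f v = 0" by simp
  qed auto
  also have "\<dots> = m (YVar i) + sum ?f ?X"
    by (subst sum.insert) auto
  also have "sum ?f ?X = (\<Sum>k\<in>UNIV. ?f (XVar (Upair i k)))"
    using sum.reindex [OF inj, of ?f] by simp
  finally show ?thesis by simp
qed

lemma ratvar_zvar: "ratvar v = zvar v + kconst (basept v)"
  by (simp add: zvar_def)

text \<open>In centred coordinates the constant parts of \<open>xvar i k\<close> contribute the pure
  second derivative in \<open>YVar i\<close>. Up to high order, \<open>sol_x_eq\<close> turns the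
  remaining second derivatives into x-derivatives, and with the y-term they form an Euler operator
  of eigenvalue \<open>mweight m i\<close>. Then \<open>sol_incr_y\<close> gives the
  cancellation.\<close>

lemma sol_y_eq:
  fixes T :: "'n::finite set"
  defines "F \<equiv> \<lambda>n. series (sol T) (Suc (Suc n))"
  shows "vge (int n + 1)
    (2 * (\<Sum>k\<in>UNIV. xvar i k * dy i (dy k (F n))) + yvar i * dy i (F n) + F n)"
proof -
  let ?z = "\<lambda>k. zvar (XVar (Upair i k))" and ?w = "\<lambda>k. weight i (XVar (Upair i k))"
  let ?e = "\<lambda>m. sol T (incr (YVar i) (incr (YVar i) m))"
  let ?g = "\<lambda>m. (of_nat (mweight m i) + 1) * sol T m"
  have dd: "dy i (dy i (F n)) = series ?e n"
    by (simp add: F_def pd_series)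
  have base: "basept (XVar (Upair i k)) = (if k = i then 1 / 2 else 0)" for k
    by (auto simp: basept_def)
  have "2 * xvar i k * dy i (dy k (F n)) =
      2 * ?z k * dy i (dy k (F n)) + (if k = i then dy i (dy i (F n)) else 0)" for k
  proof -
    have "2 * kconst (1 / 2) = (1 :: 'n ratfun)"
      using kconst_mult [of 2 "1 / 2"] by simp
    then show ?thesis
      by (simp add: xvar_def ratvar_zvar base distrib_left distrib_right mult.assoc [symmetric])
  qed
  then have 1: "2 * (\<Sum>k\<in>UNIV. xvar i k * dy i (dy k (F n))) =
      (\<Sum>k\<in>UNIV. 2 * ?z k * dy i (dy k (F n))) + series ?e n"
    by (simp add: sum_distrib_left mult.assoc [symmetric] sum.distrib dd)
  have "vge (int n + 1) (of_nat (?w k) * ?z k * dx i k (F n) - 2 * ?z k * dy i (dy k (F n)))" for k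
  proof -
    define c :: "'n ratfun" where "c = (if i = k then 1 else 2)"
    have "vge (1 + (int n + 1)) (?z k * (dx i k (F n) - c * dy i (dy k (F n))))"
      unfolding F_def by (intro vge_mult vge_zvar sol_x_eq) (simp add: c_def)
    from vge_mult [OF vge_kconst [of "of_nat (?w k)"] this]
    have "vge (int n + 1) (kconst (of_nat (?w k)) * (?z k * (dx i k (F n) - c * dy i (dy k (F n)))))"
      by (rule vge_mono) simp
    then have "vge (int n + 1) (of_nat (?w k) * (?z k * (dx i k (F n) - c * dy i (dy k (F n)))))"
      by (simp only: kconst_of_nat)
    \<comment> \<open>On the diagonal the weight is 2 and \<open>c\<close> is 1; off the diagonal it
      is the other way round.\<close>
    moreover have wc: "of_nat (?w k) * c = 2" by (auto simp: c_def)
    have "of_nat (?w k) * (?z k * (dx i k (F n) - c * dy i (dy k (F n)))) =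
       of_nat (?w k) * ?z k * dx i k (F n) - 2 * ?z k * dy i (dy k (F n))"
      unfolding wc [symmetric] by (simp only: right_diff_distrib ac_simps)
    ultimately show ?thesis by simp
  qed
  then have 2: "vge (int n + 1) (\<Sum>k\<in>UNIV. of_nat (?w k) * ?z k * dx i k (F n) - 2 * ?z k * dy i (dy k (F n)))"
    by (intro vge_sum)
  have "series ?g (Suc (Suc n)) =
      (\<Sum>k\<in>UNIV. of_nat (?w k) * ?z k * dx i k (F n)) + zvar (YVar i) * dy i (F n) + F n"
  proof -
    have "?g = (\<lambda>m. (\<Sum>k\<in>UNIV. of_nat (?w k) * (of_nat (m (XVar (Upair i k))) * sol T m)) +
        of_nat (m (YVar i)) * sol T m + sol T m)"
      unfolding mweight_eq by (simp add: fun_eq_iff distrib_right sum_distrib_right mult.assoc del: weight.simps)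
    then show ?thesis
      by (simp add: F_def series_add series_sum series_cmult zvar_pd_series mult.assoc del: weight.simps)
  qed
  moreover have "yvar i = zvar (YVar i)"
    by (simp add: yvar_def ratvar_zvar basept_def)
  \<comment> \<open>The Euler part is truncated at \<open>n + 2\<close> but the second derivative at
    \<open>n\<close>. Inserting \<open>series ?g n\<close> isolates this gap from the exact
    cancellation.\<close>
  ultimately have "2 * (\<Sum>k\<in>UNIV. xvar i k * dy i (dy k (F n))) + yvar i * dy i (F n) + F n =
     (series ?g (Suc (Suc n)) - series ?g n) + (series ?e n + series ?g n)
     - (\<Sum>k\<in>UNIV. of_nat (?w k) * ?z k * dx i k (F n) - 2 * ?z k * dy i (dy k (F n)))"
    unfolding 1 by (simp add: sum_subtractf algebra_simps)
  moreover have "series ?e n + series ?g n = 0"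
  proof -
    have "(\<lambda>m. ?e m + ?g m) = (\<lambda>_. 0)"
      by (simp add: fun_eq_iff sol_incr_y algebra_simps)
    then show ?thesis using series_add [of ?e ?g n] by simp
  qed
  moreover have "vge (int n + 1) (series ?g (Suc (Suc n)) - series ?g n)"
    by (rule vge_series_diff) simp
  ultimately show ?thesis using 2 by (simp add: vge_diff)
qed

section \<open>Ideals of differential operators\<close>

lemma diffops_simps [simp]:
  "monoid.mult (diffops A) = (\<circ>)" "monoid.one (diffops A) = id" "ring.zero (diffops A) = (\<lambda>_. 0)"
  "ring.add (diffops A) = (\<lambda>P Q f. P f + Q f)"
  by (simp_all add: diffops_def endo_ring_def)

lemma diffops_mulop: "a \<in> A \<Longrightarrow> mulop a \<in> carrier (diffops A)"
  by (simp add: diffops_def generate_ring.incl)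

lemma diffops_pd: "pd v \<in> carrier (diffops A)"
  by (simp add: diffops_def generate_ring.incl)

lemma diffops_id: "id \<in> carrier (diffops A)"
  using generate_ring.one [of endo_ring] by (simp add: diffops_def endo_ring_def)

lemma diffops_add:
  "P \<in> carrier (diffops A) \<Longrightarrow> Q \<in> carrier (diffops A) \<Longrightarrow> (\<lambda>f. P f + Q f) \<in> carrier (diffops A)"
  using generate_ring.eng_add [of _ endo_ring] by (simp add: diffops_def endo_ring_def)

lemma diffops_comp:
  "P \<in> carrier (diffops A) \<Longrightarrow> Q \<in> carrier (diffops A) \<Longrightarrow> P \<circ> Q \<in> carrier (diffops A)"
  using generate_ring.eng_mult [of _ endo_ring] by (simp add: diffops_def endo_ring_def)

lemma diffops_subset_endo: "carrier (diffops A) \<subseteq> carrier (endo_ring :: ('n::finite ratfun \<Rightarrow> 'n ratfun) ring)"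
proof -
  interpret ring "endo_ring :: ('n ratfun \<Rightarrow> 'n ratfun) ring" by (rule endo_ring_ring)
  have "mulop ` A \<union> range pd \<subseteq> carrier endo_ring"
    by (auto simp: endo_ring_def mulop_def pd_add distrib_left)
  then show ?thesis by (simp add: diffops_def generate_ring_incl)
qed

lemma endo_ring_a_inv:
  assumes "P \<in> carrier endo_ring"
  shows "\<ominus>\<^bsub>endo_ring\<^esub> P = (\<lambda>f. - P f)"
proof -
  interpret ring "endo_ring :: ('a \<Rightarrow> 'a) ring" by (rule endo_ring_ring)
  show ?thesis
    by (rule minus_equality) (use assms in \<open>auto simp: endo_ring_def\<close>)
qed

lemma diffops_uminus: "P \<in> carrier (diffops A) \<Longrightarrow> (\<lambda>f. - P f) \<in> carrier (diffops A)"
proof -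
  assume P: "P \<in> carrier (diffops A)"
  then have "\<ominus>\<^bsub>endo_ring\<^esub> P \<in> carrier (diffops A)"
    by (simp add: diffops_def generate_ring.a_inv)
  moreover have "P \<in> carrier endo_ring" using P diffops_subset_endo by blast
  ultimately show ?thesis by (simp add: endo_ring_a_inv)
qed

lemma diffops_a_inv:
  fixes A :: "'n::finite ratfun set"
  assumes "P \<in> carrier (diffops A)"
  shows "\<ominus>\<^bsub>diffops A\<^esub> P = (\<lambda>f. - P f)"
proof -
  interpret ring "diffops A" by (rule diffops_ring)
  show ?thesis
    by (rule minus_equality) (use assms diffops_uminus in auto)
qed

lemma diffops_induct [consumes 1, case_names id mulop pd uminus add comp]:
  assumes "P \<in> carrier (diffops A)"
    and id: "S id" and mulop: "\<And>a. a \<in> A \<Longrightarrow> S (mulop a)" and pd: "\<And>v. S (pd v)"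
    and uminus: "\<And>P. P \<in> carrier (diffops A) \<Longrightarrow> S P \<Longrightarrow> S (\<lambda>f. - P f)"
    and add: "\<And>P Q. P \<in> carrier (diffops A) \<Longrightarrow> Q \<in> carrier (diffops A) \<Longrightarrow>
      S P \<Longrightarrow> S Q \<Longrightarrow> S (\<lambda>f. P f + Q f)"
    and comp: "\<And>P Q. P \<in> carrier (diffops A) \<Longrightarrow> Q \<in> carrier (diffops A) \<Longrightarrow>
      S P \<Longrightarrow> S Q \<Longrightarrow> S (P \<circ> Q)"
  shows "S P"
proof -
  have carr: "carrier (diffops A) = generate_ring endo_ring (mulop ` A \<union> range pd)"
    by (simp add: diffops_def)
  from assms(1) have "P \<in> generate_ring endo_ring (mulop ` A \<union> range pd)" by (simp add: carr)
  then show ?thesis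
  proof induction
    case one
    then show ?case using id by (simp add: endo_ring_def id_def)
  next
    case (incl h)
    then show ?case using mulop pd by auto
  next
    case (a_inv h)
    then have "h \<in> carrier (diffops A)" by (simp add: carr)
    moreover from this have "h \<in> carrier endo_ring" using diffops_subset_endo by blast
    ultimately show ?case using uminus a_inv by (simp add: endo_ring_a_inv)
  next
    case (eng_add P Q)
    then show ?case using add by (simp add: carr endo_ring_def)
  next
    case (eng_mult P Q)
    have "P \<otimes>\<^bsub>endo_ring\<^esub> Q = P \<circ> Q" by (simp add: endo_ring_def)
    then show ?case using comp eng_mult by (simp only: carr)
  qed
qed

lemma left_ideal_diffopsI:
  fixes A :: "'n::finite ratfun set"
  assumes sub: "J \<subseteq> carrier (diffops A)" and zero: "(\<lambda>_. 0) \<in> J"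
    and add: "\<And>P Q. P \<in> J \<Longrightarrow> Q \<in> J \<Longrightarrow> (\<lambda>f. P f + Q f) \<in> J"
    and uminus: "\<And>P. P \<in> J \<Longrightarrow> (\<lambda>f. - P f) \<in> J"
    and comp: "\<And>P Q. P \<in> carrier (diffops A) \<Longrightarrow> Q \<in> J \<Longrightarrow> P \<circ> Q \<in> J"
  shows "left_ideal J (diffops A)"
proof -
  interpret ring "diffops A" by (rule diffops_ring)
  have "subgroup J (add_monoid (diffops A))"
  proof (rule group.subgroupI [OF a_group])
    show "J \<noteq> {}" using zero by blast
    fix P assume "P \<in> J"
    moreover from this sub have "P \<in> carrier (diffops A)" by blast
    ultimately have "inv\<^bsub>add_monoid (diffops A)\<^esub> P = (\<lambda>f. - P f)"
      using diffops_a_inv unfolding a_inv_def by blast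
    then show "inv\<^bsub>add_monoid (diffops A)\<^esub> P \<in> J"
      using uminus [OF \<open>P \<in> J\<close>] by (simp only:)
  qed (use sub add in auto)
  then show ?thesis
    using comp by (auto simp: left_ideal_def intro: additive_subgroup.intro)
qed

context
  fixes A :: "'n::finite ratfun set" and J
  assumes J: "left_ideal J (diffops A)"
begin

interpretation ring "diffops A" by (rule diffops_ring)
interpretation J: additive_subgroup J "diffops A"
  using J by (simp add: left_ideal_def)

lemma left_ideal_subset: "P \<in> J \<Longrightarrow> P \<in> carrier (diffops A)"
  using J.a_subset by blast

lemma left_ideal_zero: "(\<lambda>_. 0) \<in> J"
  using J.zero_closed by simp

lemma left_ideal_add: "P \<in> J \<Longrightarrow> Q \<in> J \<Longrightarrow> (\<lambda>f. P f + Q f) \<in> J"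
  using J.a_closed by simp

lemma left_ideal_comp: "P \<in> carrier (diffops A) \<Longrightarrow> Q \<in> J \<Longrightarrow> P \<circ> Q \<in> J"
  using J by (simp add: left_ideal_def)

lemma left_ideal_uminus: "P \<in> J \<Longrightarrow> (\<lambda>f. - P f) \<in> J"
  using J.a_inv_closed [of P] diffops_a_inv [OF left_ideal_subset, of P] by simp

end

section \<open>Generated left ideals and change of rings\<close>

lemma gen_left_ideal_least: "left_ideal J R \<Longrightarrow> S \<subseteq> J \<Longrightarrow> gen_left_ideal R S \<subseteq> J"
  by (auto simp: gen_left_ideal_def)

lemma gen_left_ideal_incl: "S \<subseteq> gen_left_ideal R S"
  by (auto simp: gen_left_ideal_def)

lemma diffops_mono:
  assumes "A \<subseteq> B" shows "carrier (diffops A) \<subseteq> carrier (diffops B)"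
proof
  fix P assume "P \<in> carrier (diffops A)"
  then show "P \<in> carrier (diffops B)"
    by (induction rule: diffops_induct)
      (use assms in \<open>blast intro: diffops_id diffops_mulop diffops_pd diffops_uminus diffops_add diffops_comp\<close>)+
qed

text \<open>The larger ideal meets the smaller ring in a left ideal of that ring, which contains
  \<open>S\<close>. This gives generators of the extension of an ideal of the Weyl algebra.\<close>

lemma gen_left_ideal_trans:
  assumes "A \<subseteq> B" "S \<subseteq> carrier (diffops A)"
  shows "gen_left_ideal (diffops B) (gen_left_ideal (diffops A) S) = gen_left_ideal (diffops B) S"
proof (rule equalityI; rule gen_left_ideal_least)
  interpret B: ring "diffops B" by (rule diffops_ring)
  interpret A: ring "diffops A" by (rule diffops_ring)
  let ?J = "gen_left_ideal (diffops B) S"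
  note mono = diffops_mono [OF assms(1)]
  show J: "left_ideal ?J (diffops B)"
    using assms mono by (intro B.gen_left_ideal_left_ideal) blast
  have "left_ideal (?J \<inter> carrier (diffops A)) (diffops A)"
    using mono
    by (intro left_ideal_diffopsI)
      (auto intro: left_ideal_zero [OF J] left_ideal_add [OF J] left_ideal_uminus [OF J]
        left_ideal_comp [OF J] diffops_add diffops_comp diffops_uminus
        left_ideal_zero [OF A.gen_left_ideal_left_ideal [OF assms(2)]]
        A.zero_closed [simplified])
  then show "gen_left_ideal (diffops A) S \<subseteq> ?J"
    using gen_left_ideal_least [of "?J \<inter> carrier (diffops A)" "diffops A" S]
      gen_left_ideal_incl [of S "diffops B"] assms(2) by blast
  have "gen_left_ideal (diffops A) S \<subseteq> carrier (diffops A)"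
    using A.gen_left_ideal_left_ideal [OF assms(2)] left_ideal_subset by blast
  then show "left_ideal (gen_left_ideal (diffops B) (gen_left_ideal (diffops A) S)) (diffops B)"
    using mono by (intro B.gen_left_ideal_left_ideal) blast
  show "S \<subseteq> gen_left_ideal (diffops B) (gen_left_ideal (diffops A) S)"
    using gen_left_ideal_incl [of S "diffops A"]
      gen_left_ideal_incl [of "gen_left_ideal (diffops A) S" "diffops B"] by blast
qed

text \<open>A multiplication loses at most a constant determined by its factor, a derivative at most
  1; losses add up under composition and are bounded by the maximum for sums.\<close>

lemma rat_diffops_vge:
  assumes "P \<in> carrier (diffops A)"
  shows "\<exists>k. \<forall>n f. vge n f \<longrightarrow> vge (n - k) (P f)"
  using assms
proof (induction rule: diffops_induct)
  case id
  show ?case by (intro exI [of _ 0]) simp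
next
  case (mulop a)
  obtain v where "vge v a" using vge_lower by blast
  then show ?case
    using vge_mult [of v a] by (intro exI [of _ "- v"]) (simp add: mulop_def add.commute)
next
  case (pd v)
  show ?case by (intro exI [of _ 1]) (simp add: vge_pd)
next
  case (uminus P)
  then show ?case using vge_uminus by blast
next
  case (add P Q)
  then obtain k l where k: "\<And>n f. vge n f \<Longrightarrow> vge (n - k) (P f)" "\<And>n f. vge n f \<Longrightarrow> vge (n - l) (Q f)"
    by blast
  have "vge (n - max k l) (P f + Q f)" if "vge n f" for n f
    by (intro vge_add vge_mono [OF k(1) [OF that]] vge_mono [OF k(2) [OF that]]) auto
  then show ?case by blast
next
  case (comp P Q)
  then obtain k l where k: "\<And>n f. vge n f \<Longrightarrow> vge (n - k) (P f)" "\<And>n f. vge n f \<Longrightarrow> vge (n - l) (Q f)"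
    by blast
  have "vge (n - (l + k)) ((P \<circ> Q) f)" if "vge n f" for n f
    using k(1) [OF k(2) [OF that]] by (simp add: diff_diff_eq)
  then show ?case by blast
qed

text \<open>Stands for the operators that annihilate the formal limit of \<open>F\<close>, expressed
  through its rational truncations.\<close>

definition asymptotic_annihilator :: "(nat \<Rightarrow> 'n::finite ratfun) \<Rightarrow> ('n ratfun \<Rightarrow> 'n ratfun) set"
  where "asymptotic_annihilator F =
    {P \<in> carrier (diffops UNIV). \<forall>N. eventually (\<lambda>n. vge N (P (F n))) sequentially}"

text \<open>Composition from the left is harmless because an operator loses a bounded order, whereas
  the order along \<open>F\<close> grows beyond every bound.\<close>

lemma left_ideal_asymptotic_annihilator: "left_ideal (asymptotic_annihilator F) (diffops UNIV)"
proof (rule left_ideal_diffopsI)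
  interpret ring "diffops UNIV" by (rule diffops_ring)
  show "(\<lambda>_. 0) \<in> asymptotic_annihilator F"
    using zero_closed by (simp add: asymptotic_annihilator_def)
  fix P Q :: "'a ratfun \<Rightarrow> 'a ratfun"
  assume P: "P \<in> asymptotic_annihilator F" and Q: "Q \<in> asymptotic_annihilator F"
  then show "(\<lambda>f. P f + Q f) \<in> asymptotic_annihilator F"
    by (auto simp: asymptotic_annihilator_def intro: diffops_add vge_add eventually_elim2)
next
  fix P :: "'a ratfun \<Rightarrow> 'a ratfun"
  assume "P \<in> asymptotic_annihilator F"
  then show "(\<lambda>f. - P f) \<in> asymptotic_annihilator F"
    by (auto simp: asymptotic_annihilator_def intro: diffops_uminus vge_uminus eventually_mono)
next
  fix P Q :: "'a ratfun \<Rightarrow> 'a ratfun"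
  assume P: "P \<in> carrier (diffops UNIV)" and Q: "Q \<in> asymptotic_annihilator F"
  obtain k where k: "\<And>n f. vge n f \<Longrightarrow> vge (n - k) (P f)" using rat_diffops_vge [OF P] by blast
  have "eventually (\<lambda>n. vge N (P (Q (F n)))) sequentially" for N
  proof -
    have "eventually (\<lambda>n. vge (N + k) (Q (F n))) sequentially"
      using Q by (simp add: asymptotic_annihilator_def)
    then show ?thesis by (rule eventually_mono) (use k [of "N + k"] in simp)
  qed
  then show "P \<circ> Q \<in> asymptotic_annihilator F"
    using P Q by (simp add: asymptotic_annihilator_def diffops_comp)
qed (auto simp: asymptotic_annihilator_def)

section \<open>The generators and the independence of the squarefree monomials\<close>

definition gen_y :: "'n::finite \<Rightarrow> 'n ratfun \<Rightarrow> 'n ratfun"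
  where "gen_y i f = 2 * (\<Sum>k\<in>UNIV. xvar i k * dy i (dy k f)) + yvar i * dy i f + f"

definition gen_x :: "'n::finite \<Rightarrow> 'n \<Rightarrow> 'n ratfun \<Rightarrow> 'n ratfun"
  where "gen_x i j f = dx i j f - (if i = j then 1 else 2) * dy i (dy j f)"

lemma gen_x_commute: "gen_x i j = gen_x j i"
proof
  fix f :: "'a ratfun"
  have "dx i j f = dx j i f"
    by (rule arg_cong [of _ _ "\<lambda>u. pd (XVar u) f"]) simp
  then show "gen_x i j f = gen_x j i f"
    using pd_commute [of "YVar i" "YVar j" f] by (simp add: gen_x_def)
qed

definition gens :: "('n::finite ratfun \<Rightarrow> 'n ratfun) set"
  where "gens = range gen_y \<union> range (\<lambda>(i, j). gen_x i j)"

lemma gens_weyl: "gens \<subseteq> carrier (diffops (range (\<lambda>p. Fract p 1)))"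
proof -
  let ?W = "carrier (diffops (range (\<lambda>p. Fract p 1))) :: ('a ratfun \<Rightarrow> 'a ratfun) set"
  have mul: "(\<lambda>f. c * P f) \<in> ?W" if "c \<in> range (\<lambda>p. Fract p 1)" "P \<in> ?W" for c P
    using diffops_comp [OF diffops_mulop [OF that(1)] that(2)] by (simp add: comp_def mulop_def)
  have pd: "(\<lambda>f. pd v (P f)) \<in> ?W" if "P \<in> ?W" for v P
    using diffops_comp [OF diffops_pd that] by (simp add: comp_def)
  have id: "(\<lambda>f. f) \<in> ?W" using diffops_id by (simp add: id_def)
  have zero: "(\<lambda>f. 0) \<in> ?W"
  proof -
    interpret ring "diffops (range (\<lambda>p. Fract p 1)) :: ('a ratfun \<Rightarrow> 'a ratfun) ring" by (rule diffops_ring)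
    show ?thesis using zero_closed by simp
  qed
  have sum: "(\<lambda>f. \<Sum>a\<in>S. P a f) \<in> ?W" if "\<And>a. a \<in> S \<Longrightarrow> P a \<in> ?W" for P and S :: "'a set"
    using that
  proof (induction S rule: infinite_finite_induct)
    case (insert a S)
    then show ?case using diffops_add [of "P a" _ "\<lambda>f. \<Sum>a\<in>S. P a f"] by simp
  qed (simp_all add: zero)
  have coeff: "xvar i k \<in> range (\<lambda>p. Fract p 1)" "yvar i \<in> range (\<lambda>p. Fract p 1)"
    "kconst c \<in> range (\<lambda>p. Fract p 1)" for i k :: 'a and c
    by (simp_all add: xvar_def yvar_def ratvar_def kconst_def)
  have two: "2 \<in> range (\<lambda>p. Fract p 1 :: 'a ratfun)" "1 \<in> range (\<lambda>p. Fract p 1 :: 'a ratfun)"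
    using coeff(3) [of 2] coeff(3) [of 1] by simp_all
  have "gen_y i \<in> ?W" for i
    unfolding gen_y_def [abs_def]
    by (intro diffops_add mul sum pd id coeff two)
  moreover have "gen_x i j \<in> ?W" for i j
    unfolding gen_x_def [abs_def] diff_conv_add_uminus
    by (intro diffops_add diffops_uminus mul pd id) (use two in auto)
  ultimately show ?thesis by (auto simp: gens_def)
qed

lemma gens_sol: "gens \<subseteq> asymptotic_annihilator (\<lambda>n. series (sol T) n)"
proof
  fix P :: "'a ratfun \<Rightarrow> 'a ratfun" assume P: "P \<in> gens"
  have *: "vge (int n + 1) (P (series (sol T) (Suc (Suc n))))" for n
    using P sol_y_eq [of n _ T] sol_x_eq [OF refl, of n _ _ T]
    by (auto simp: gens_def gen_y_def gen_x_def)
  have "eventually (\<lambda>n. vge N (P (series (sol T) n))) sequentially" for N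
    unfolding eventually_sequentially
  \<comment> \<open>The offset 2 is the one in the truncation degree of the estimates
    \<open>sol_x_eq\<close> and \<open>sol_y_eq\<close>.\<close>
  proof (intro exI [of _ "Suc (Suc (nat N))"] allI impI)
    fix n assume n: "Suc (Suc (nat N)) \<le> n"
    then obtain m where m: "n = Suc (Suc m)" by (metis Suc_le_D Suc_le_mono)
    show "vge N (P (series (sol T) n))"
      using n unfolding m by (intro vge_mono [OF *]) auto
  qed
  moreover have "P \<in> carrier (diffops UNIV)"
    using P gens_weyl diffops_mono [of "range (\<lambda>p. Fract p 1)" UNIV] by blast
  ultimately show "P \<in> asymptotic_annihilator (\<lambda>n. series (sol T) n)"
    by (simp add: asymptotic_annihilator_def)
qed

lemma dys_independent:
  fixes a :: "'n::finite set \<Rightarrow> 'n ratfun"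
  assumes "(\<lambda>f. \<Sum>S\<in>UNIV. a S * dys (mset_set S) f) \<in> gen_left_ideal (diffops UNIV) gens"
  shows "a S = 0"
proof (rule ccontr)
  assume "a S \<noteq> 0"
  then obtain N where N: "\<And>M. (\<And>S T. S \<in> UNIV \<Longrightarrow> T \<in> UNIV \<Longrightarrow> vge 1 (M S T - of_bool (S = T))) \<Longrightarrow>
      \<exists>T\<in>UNIV. \<not> vge N (\<Sum>S\<in>UNIV. a S * M S T)"
    by (rule near_identity_vge [OF finite_class.finite_UNIV _ UNIV_I, of a S]) blast
  let ?M = "\<lambda>n S T. dys (mset_set S) (series (sol T) n)"
  have "eventually (\<lambda>n. vge N (\<Sum>S\<in>UNIV. a S * ?M n S T)) sequentially" for T
    using gen_left_ideal_least [OF left_ideal_asymptotic_annihilator gens_sol [of T]] assms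
    by (auto simp: asymptotic_annihilator_def)
  then have "eventually (\<lambda>n. \<forall>T\<in>UNIV. vge N (\<Sum>S\<in>UNIV. a S * ?M n S T)) sequentially"
    by (intro eventually_ball_finite) auto
  \<comment> \<open>\<open>N\<close> is already fixed. The condition \<open>CARD('n) \<le> n\<close>
    makes the truncations long enough for \<open>dys_sol\<close> at all \<open>S\<close>
    simultaneously.\<close>
  then have "eventually (\<lambda>n. (\<forall>T\<in>UNIV. vge N (\<Sum>S\<in>UNIV. a S * ?M n S T)) \<and> CARD('n) \<le> n) sequentially"
    by (intro eventually_conj eventually_ge_at_top)
  then obtain n where n: "\<And>T. vge N (\<Sum>S\<in>UNIV. a S * ?M n S T)" "CARD('n) \<le> n"
    by (auto dest!: eventually_happens)
  have "vge 1 (?M n S T - of_bool (S = T))" for S T :: "'n set"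
    using n(2) card_mono [of UNIV S] by (intro dys_sol) auto
  from N [OF this] n(1) show False by blast
qed

section \<open>Reduction to squarefree monomials\<close>

lemma pd_yvar_xvar [simp]: "dy k (xvar i j) = 0"
  by (simp add: xvar_def pd_ratvar)

lemma pd_yvar_yvar: "dy k (yvar i) = of_bool (k = i)"
  by (simp add: yvar_def pd_ratvar)

lemma dys_add: "dys M (f + g) = dys M f + dys M g"
  by (induction M) (simp_all add: pd_add)

lemma dys_0 [simp]: "dys M 0 = 0"
  by (induction M) simp_all

lemma dys_sum: "dys M (sum f A) = (\<Sum>a\<in>A. dys M (f a))"
  by (induction A rule: infinite_finite_induct) (simp_all add: dys_add)

lemma dys_pd: "dys M (pd v f) = pd v (dys M f)"
  by (induction M) (simp_all add: pd_commute [of v])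

lemma dys_const_mult: "(\<And>k. dy k c = 0) \<Longrightarrow> dys M (c * f) = c * dys M f"
  by (induction M) (simp_all add: pd_mult)

text \<open>The Leibniz rule; as \<open>yvar i\<close> is linear, a single correction term
  arises.\<close>

lemma dys_yvar_mult:
  "dys M (yvar i * f) = yvar i * dys M f + of_nat (count M i) * dys (M - {#i#}) f"
proof (induction M)
  case (add k M)
  have of_nat: "dy k (of_nat (count M i)) = 0"
    using pd_kconst [of "YVar k" "of_nat (count M i)"] by (simp only: kconst_of_nat)
  show ?case
  proof (cases "k = i")
    case True
    have "of_nat (count M i) * dy i (dys (M - {#i#}) f) = of_nat (count M i) * dys M f"
      by (cases "i \<in># M") (auto simp: not_in_iff simp flip: dys_add_mset)
    moreover have "dy i (yvar i * dys M f + of_nat (count M i) * dys (M - {#i#}) f) =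
        dys M f + yvar i * dy i (dys M f) + of_nat (count M i) * dy i (dys (M - {#i#}) f)"
      using of_nat True by (simp add: pd_add pd_mult pd_yvar_yvar)
    ultimately show ?thesis by (simp add: add True distrib_right)
  next
    case False
    then have "add_mset k M - {#i#} = add_mset k (M - {#i#})" by simp
    with False show ?thesis
      using of_nat by (simp add: add pd_add pd_mult pd_yvar_yvar)
  qed
qed simp

lemma dys_diffops: "dys (M :: 'n::finite multiset) \<in> carrier (diffops A)"
proof (induction M)
  case empty
  have "dys {#} = (id :: 'n ratfun \<Rightarrow> 'n ratfun)" by (simp add: fun_eq_iff)
  then show ?case by (simp only: diffops_id)
next
  case (add k M)
  have "dys (add_mset k M) = dy k \<circ> dys M" by (simp add: fun_eq_iff)
  then show ?case using add by (simp only: diffops_comp diffops_pd)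
qed

text \<open>A matrix congruent to the identity modulo the maximal ideal of the base point has
  trivial kernel by \<open>near_identity_vge\<close>, hence a left inverse. Padding by the identity
  extends the submatrix to all indices.\<close>

lemma submatrix_left_inverse:
  fixes S :: "'n::finite set"
  obtains c where "\<And>j k. j \<in> S \<Longrightarrow> k \<in> S \<Longrightarrow> (\<Sum>i\<in>S. c j i * (2 * xvar i k)) = of_bool (j = k)"
proof -
  define A :: "'n ratfun ^ 'n ^ 'n" where
    "A = (\<chi> i k. if i \<in> S \<and> k \<in> S then 2 * xvar i k else of_bool (i = k))"
  have near: "vge 1 (A $ i $ k - of_bool (k = i))" for i k
  proof (cases "i \<in> S \<and> k \<in> S")
    case True
    have half: "2 * kconst (1 / 2) = (1 :: 'n ratfun)"
      using kconst_mult [of 2 "1 / 2"] by simp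
    have "basept (XVar (Upair i k)) = (if k = i then 1 / 2 else 0)"
      by (auto simp: basept_def)
    then have "A $ i $ k - of_bool (k = i) = 2 * zvar (XVar (Upair i k))"
      using True half by (auto simp: A_def xvar_def ratvar_zvar distrib_left)
    then show ?thesis
      using vge_mult [OF vge_kconst [of 2] vge_zvar [of "XVar (Upair i k)"]] by simp
  qed (auto simp: A_def)
  have "x = 0" if x: "A *v x = 0" for x
  proof (rule ccontr)
    assume "x \<noteq> 0"
    then obtain k where k: "x $ k \<noteq> 0" by (auto simp: vec_eq_iff)
    obtain N where N: "\<And>M. (\<And>s t. s \<in> UNIV \<Longrightarrow> t \<in> UNIV \<Longrightarrow> vge 1 (M s t - of_bool (s = t))) \<Longrightarrow>
      \<exists>t\<in>UNIV. \<not> vge N (\<Sum>s\<in>UNIV. x $ s * M s t)"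
      by (rule near_identity_vge [OF finite_class.finite_UNIV _ UNIV_I, of "\<lambda>s. x $ s" k]) (use k in blast)+
    have "(\<Sum>s\<in>UNIV. x $ s * A $ t $ s) = 0" for t
      using arg_cong [OF x, of "\<lambda>y. y $ t"] by (simp add: matrix_vector_mult_def mult.commute)
    with N [of "\<lambda>s t. A $ t $ s"] near show False by auto
  qed
  then obtain B where B: "B ** A = mat 1"
    using matrix_left_invertible_ker [of A] by blast
  have eq: "(\<Sum>i\<in>UNIV. B $ j $ i * A $ i $ k) = of_bool (j = k)" for j k
    using arg_cong [OF B, of "\<lambda>M. M $ j $ k"] by (simp add: matrix_matrix_mult_def mat_def of_bool_def)
  \<comment> \<open>Column \<open>k\<close> of \<open>A\<close> is a unit vector for
    \<open>k\<close> outside \<open>S\<close>, so \<open>B ** A = mat 1\<close> reads off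
    \<open>B $ j $ k\<close>. The padding thus drops out of the rows from \<open>S\<close>.\<close>
  have zero: "B $ j $ k = 0" if "j \<in> S" "k \<notin> S" for j k
  proof -
    have "(\<Sum>i\<in>UNIV. B $ j $ i * A $ i $ k) = (\<Sum>i\<in>UNIV. if i = k then B $ j $ i else 0)"
      using that by (intro sum.cong) (auto simp: A_def)
    moreover have "j \<noteq> k" using that by auto
    ultimately show ?thesis using eq [of j k] by simp
  qed
  show ?thesis
  proof (rule that [of "\<lambda>j i. B $ j $ i"])
    fix j k assume jk: "j \<in> S" "k \<in> S"
    have "(\<Sum>i\<in>S. B $ j $ i * (2 * xvar i k)) = (\<Sum>i\<in>S. B $ j $ i * A $ i $ k)"
      using jk by (intro sum.cong) (auto simp: A_def)
    also have "\<dots> = (\<Sum>i\<in>UNIV. B $ j $ i * A $ i $ k)"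
      using jk zero by (intro sum.mono_neutral_left) auto
    finally show "(\<Sum>i\<in>S. B $ j $ i * (2 * xvar i k)) = of_bool (j = k)" by (simp add: eq)
  qed
qed

section \<open>Reduction modulo the ideal\<close>

definition rel_ideal :: "('n::finite ratfun \<Rightarrow> 'n ratfun) set"
  where "rel_ideal = gen_left_ideal (diffops UNIV) gens"

lemma left_ideal_rel_ideal: "left_ideal (rel_ideal :: ('n::finite ratfun \<Rightarrow> 'n ratfun) set) (diffops UNIV)"
proof -
  interpret ring "diffops (UNIV :: 'n ratfun set)" by (rule diffops_ring)
  have "gens \<subseteq> carrier (diffops (UNIV :: 'n ratfun set))"
    using gens_weyl diffops_mono [of "range (\<lambda>p. Fract p 1)" UNIV] by blast
  then show ?thesis unfolding rel_ideal_def by (rule gen_left_ideal_left_ideal)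
qed

lemma dys_comp_rel_ideal: "P \<in> gens \<Longrightarrow> (\<lambda>f. dys M (P f)) \<in> rel_ideal"
  using left_ideal_comp [OF left_ideal_rel_ideal dys_diffops, of P M]
    gen_left_ideal_incl [of gens "diffops UNIV"] by (auto simp: rel_ideal_def comp_def)

definition reducible :: "('n::finite ratfun \<Rightarrow> 'n ratfun) \<Rightarrow> bool"
  where "reducible P \<longleftrightarrow>
    (\<exists>a Q. Q \<in> rel_ideal \<and> P = (\<lambda>f. Q f + (\<Sum>S\<in>UNIV. a S * dys (mset_set S) f)))"

lemma reducible_rel_ideal: "P \<in> rel_ideal \<Longrightarrow> reducible P"
  unfolding reducible_def by (intro exI [of _ "\<lambda>_. 0"] exI [of _ P]) simp

lemma reducible_dys_set: "reducible (dys (mset_set S))"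
  unfolding reducible_def
  by (intro exI [of _ "\<lambda>T. of_bool (T = S)"] exI [of _ "\<lambda>_. 0"])
    (simp add: left_ideal_zero [OF left_ideal_rel_ideal] of_bool_def if_distrib if_distribR cong: if_cong)

lemma reducible_add:
  assumes "reducible P" "reducible Q" shows "reducible (\<lambda>f. P f + Q f)"
proof -
  obtain a P' b Q' where *: "P' \<in> rel_ideal" "P = (\<lambda>f. P' f + (\<Sum>S\<in>UNIV. a S * dys (mset_set S) f))"
    "Q' \<in> rel_ideal" "Q = (\<lambda>f. Q' f + (\<Sum>S\<in>UNIV. b S * dys (mset_set S) f))"
    using assms unfolding reducible_def by auto
  show ?thesis
    unfolding reducible_def
    by (intro exI [of _ "\<lambda>S. a S + b S"] exI [of _ "\<lambda>f. P' f + Q' f"] conjI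
        left_ideal_add [OF left_ideal_rel_ideal] * ext)
      (simp add: * distrib_right sum.distrib)
qed

lemma reducible_scale:
  assumes "reducible P" shows "reducible (\<lambda>f. c * P f)"
proof -
  obtain a P' where *: "P' \<in> rel_ideal" "P = (\<lambda>f. P' f + (\<Sum>S\<in>UNIV. a S * dys (mset_set S) f))"
    using assms unfolding reducible_def by auto
  have "(\<lambda>f. c * P' f) \<in> rel_ideal"
    using left_ideal_comp [OF left_ideal_rel_ideal diffops_mulop, of c P'] *
    by (simp add: comp_def mulop_def)
  then show ?thesis
    unfolding reducible_def
    by (intro exI [of _ "\<lambda>S. c * a S"] exI [of _ "\<lambda>f. c * P' f"])
      (simp add: * distrib_left sum_distrib_left mult.assoc)
qed

lemma reducible_uminus: "reducible P \<Longrightarrow> reducible (\<lambda>f. - P f)"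
  using reducible_scale [of P "- 1"] by simp

lemma reducible_diff: "reducible P \<Longrightarrow> reducible Q \<Longrightarrow> reducible (\<lambda>f. P f - Q f)"
  using reducible_add [OF _ reducible_uminus, of P Q] by simp

lemma reducible_zero: "reducible (\<lambda>_. 0)"
  by (rule reducible_rel_ideal) (rule left_ideal_zero [OF left_ideal_rel_ideal])

lemma reducible_sum: "(\<And>a. a \<in> S \<Longrightarrow> reducible (P a)) \<Longrightarrow> reducible (\<lambda>f. \<Sum>a\<in>S. P a f)"
proof (induction S rule: infinite_finite_induct)
  case (insert a S)
  then show ?case using reducible_add [of "P a" "\<lambda>f. \<Sum>a\<in>S. P a f"] by simp
qed (simp_all add: reducible_zero)

text \<open>This is \<open>gen_y i\<close> differentiated by \<open>M\<close> with one
  \<open>i\<close> removed. The Leibniz correction and the constant term of the generator add up to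
  \<open>count M i\<close>.\<close>

lemma dys_relation:
  assumes "i \<in># M"
  shows "(\<lambda>f. (\<Sum>k\<in>UNIV. 2 * xvar i k * dys (add_mset k M) f) + yvar i * dys M f +
    of_nat (count M i) * dys (M - {#i#}) f) \<in> rel_ideal"
proof -
  obtain B where B: "M = add_mset i B" using assms by (metis insert_DiffM)
  have two: "dy k (2 :: 'a ratfun) = 0" for k
    using pd_kconst [of "YVar k" 2] by simp
  have "dys B (gen_y i f) = (\<Sum>k\<in>UNIV. 2 * xvar i k * dys (add_mset k M) f) + yvar i * dys M f +
    of_nat (count M i) * dys (M - {#i#}) f" for f
  proof -
    have "of_nat (count B i) * dys (B - {#i#}) (dy i f) = of_nat (count B i) * dys B f"
      by (cases "i \<in># B") (auto simp: dys_pd not_in_iff simp flip: dys_add_mset)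
    moreover have "dy k (dy i g) = dy i (dy k g)" for k g by (rule pd_commute)
    ultimately show ?thesis
      unfolding gen_y_def B
      by (simp add: dys_add dys_const_mult two dys_sum dys_yvar_mult dys_pd sum_distrib_left
          mult.assoc distrib_right)
  qed
  moreover have "gen_y i \<in> gens" by (simp add: gens_def)
  ultimately show ?thesis using dys_comp_rel_ideal [of "gen_y i" B] by simp
qed

text \<open>Induction on the order and, for fixed order, on the number of variables that do not occur:
  inverting the submatrix of the occurring variables trades a repeated one for a new one.\<close>

lemma reducible_dys: "reducible (dys (M :: 'n::finite multiset))"
proof (induction M rule: wf_induct_rule [OF wf_measures [of "[size, \<lambda>M. CARD('n) - card (set_mset M)]"]])
  case (1 M)
  show ?case
  proof (cases "\<forall>k. count M k \<le> 1")
    case True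
    then have "count M k = count (mset_set (set_mset M)) k" for k
      by (metis count_greater_zero_iff count_mset_set(1,3) finite_set_mset le_neq_implies_less less_one not_in_iff)
    then have "M = mset_set (set_mset M)" by (rule multiset_eqI)
    then show ?thesis by (metis reducible_dys_set)
  next
    case False
    then obtain k where "\<not> count M k \<le> 1" by blast
    then have k: "count M k \<ge> 2" by simp
    \<comment> \<open>Removing one copy of the repeated index keeps the support, so every
      \<open>i\<close> in \<open>S\<close> occurs in \<open>B\<close> and yields a relation.\<close>
    define B where "B = M - {#k#}"
    define S where "S = set_mset M"
    have kB: "k \<in># B" using k by (simp add: B_def flip: count_greater_zero_iff)
    have M: "M = add_mset k B" using k by (simp add: B_def flip: count_greater_zero_iff)
    have S: "S = set_mset B" using kB by (auto simp: S_def M)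
    have kS: "k \<in> S" using kB by (simp add: S)
    obtain c where c: "\<And>j l. j \<in> S \<Longrightarrow> l \<in> S \<Longrightarrow> (\<Sum>i\<in>S. c j i * (2 * xvar i l)) = of_bool (j = l)"
      using submatrix_left_inverse [of S] by blast
    let ?D = "\<lambda>l. dys (add_mset l B)"
    define low where "low i f = yvar i * dys B f + of_nat (count B i) * dys (B - {#i#}) f" for i f
    define rel where "rel i f = (\<Sum>l\<in>UNIV. 2 * xvar i l * ?D l f) + low i f" for i f
    have rel: "reducible (rel i)" if "i \<in> S" for i
      using dys_relation [of i B] that
      by (intro reducible_rel_ideal) (simp add: S rel_def [abs_def] low_def add.assoc)
    have low: "reducible (low i)" if "i \<in> S" for i
      unfolding low_def [abs_def] using that
      by (intro reducible_add reducible_scale 1) (auto simp: M S size_Diff_singleton)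
    \<comment> \<open>The order is that of \<open>M\<close>, but \<open>l\<close> is a new index.
      The bound by \<open>CARD('n)\<close> makes the truncated subtraction in the second measure
      drop strictly.\<close>
    have new: "reducible (?D l)" if "l \<in> - S" for l
    proof (rule 1)
      have "card (insert l S) \<le> CARD('n)" by (rule card_mono) auto
      then show "(add_mset l B, M) \<in> measures [size, \<lambda>M. CARD('n) - card (set_mset M)]"
        using that kB by (auto simp: M S insert_absorb)
    qed
    \<comment> \<open>Row \<open>k\<close> of the inverse, applied to the relations for
      \<open>i\<close> in \<open>S\<close>, eliminates all \<open>?D l\<close> with \<open>l\<close>
      in \<open>S\<close> except \<open>?D k\<close>, which is \<open>dys M\<close>.\<close>
    have "dys M f = (\<Sum>i\<in>S. c k i * rel i f) - (\<Sum>i\<in>S. c k i * low i f) -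
      (\<Sum>l\<in>- S. (\<Sum>i\<in>S. c k i * (2 * xvar i l)) * ?D l f)" for f
    proof -
      let ?g = "\<lambda>l. (\<Sum>i\<in>S. c k i * (2 * xvar i l)) * ?D l f"
      have "(\<Sum>i\<in>S. c k i * rel i f) - (\<Sum>i\<in>S. c k i * low i f) =
          (\<Sum>i\<in>S. \<Sum>l\<in>UNIV. c k i * (2 * xvar i l) * ?D l f)"
        by (simp add: rel_def distrib_left sum.distrib sum_distrib_left mult.assoc)
      also have "\<dots> = (\<Sum>l\<in>UNIV. ?g l)"
        by (subst sum.swap) (simp add: sum_distrib_right)
      also have "\<dots> = (\<Sum>l\<in>S. ?g l) + (\<Sum>l\<in>- S. ?g l)"
        by (subst sum.union_disjoint [symmetric]) auto
      also have "(\<Sum>l\<in>S. ?g l) = (\<Sum>l\<in>S. of_bool (k = l) * ?D l f)"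
        by (intro sum.cong refl) (simp only: c [OF kS])
      also have "\<dots> = dys M f"
        using kB by (simp add: of_bool_def if_distribR if_distrib S M cong: if_cong)
      finally show ?thesis by simp
    qed
    then have "dys M = (\<lambda>f. (\<Sum>i\<in>S. c k i * rel i f) - (\<Sum>i\<in>S. c k i * low i f) -
      (\<Sum>l\<in>- S. (\<Sum>i\<in>S. c k i * (2 * xvar i l)) * ?D l f))"
      by (rule ext)
    then show ?thesis
      by (simp only:) (intro reducible_diff reducible_sum reducible_scale rel low new; assumption)
  qed
qed

text \<open>An x-derivative is traded for two y-derivatives by \<open>gen_x\<close>; the higher
  order is harmless, as \<open>reducible_dys\<close> covers every monomial.\<close>

lemma reducible_pd_dys: "reducible (\<lambda>f. pd v (dys M f))"
proof (cases v)
  case (YVar k)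
  have "dys (add_mset k M) = (\<lambda>f. dy k (dys M f))" by (rule ext) simp
  then show ?thesis using reducible_dys [of "add_mset k M"] YVar by (simp only:)
next
  case (XVar u)
  obtain i j where u: "u = Upair i j" by (cases u)
  let ?c = "if i = j then 1 else 2 :: 'a ratfun"
  have "dy k ?c = 0" for k
    using pd_kconst [of "YVar k" 2] by simp
  then have "dys M (gen_x i j f) = dx i j (dys M f) - ?c * dys (add_mset i (add_mset j M)) f" for f
    using dys_add [of M "gen_x i j f" "?c * dy i (dy j f)"]
    by (simp add: gen_x_def dys_pd dys_const_mult)
  then have "pd v (dys M f) = dys M (gen_x i j f) + ?c * dys (add_mset i (add_mset j M)) f" for f
    by (simp add: XVar u)
  moreover have "reducible (\<lambda>f. dys M (gen_x i j f) + ?c * dys (add_mset i (add_mset j M)) f)"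
    by (intro reducible_add reducible_scale reducible_dys reducible_rel_ideal dys_comp_rel_ideal)
      (auto simp: gens_def)
  ultimately show ?thesis by simp
qed

lemma reducible_pd:
  assumes "reducible P" shows "reducible (\<lambda>f. pd v (P f))"
proof -
  obtain a P' where *: "P' \<in> rel_ideal" "P = (\<lambda>f. P' f + (\<Sum>S\<in>UNIV. a S * dys (mset_set S) f))"
    using assms unfolding reducible_def by auto
  have "(\<lambda>f. pd v (P' f)) \<in> rel_ideal"
    using left_ideal_comp [OF left_ideal_rel_ideal diffops_pd, of P' v] * by (simp add: comp_def)
  then have "reducible (\<lambda>f. pd v (P' f) + (\<Sum>S\<in>UNIV. pd v (a S) * dys (mset_set S) f +
      a S * pd v (dys (mset_set S) f)))"
    by (intro reducible_add reducible_sum reducible_scale reducible_dys reducible_pd_dys reducible_rel_ideal)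
  then show ?thesis by (simp add: * pd_add pd_sum pd_mult)
qed

lemma reducible_diffops:
  fixes P :: "'n::finite ratfun \<Rightarrow> 'n ratfun"
  assumes "P \<in> carrier (diffops UNIV)" shows "reducible P"
proof -
  \<comment> \<open>Composition on the left with a reducible \<open>Q\<close> is the form that
    passes through the composition case; taking the identity for \<open>Q\<close> gives the
    claim.\<close>
  have "\<forall>Q. reducible Q \<longrightarrow> reducible (\<lambda>f. P (Q f))"
    using assms
  proof (induction rule: diffops_induct)
    case (mulop a)
    then show ?case by (simp add: mulop_def reducible_scale)
  qed (simp_all add: reducible_pd reducible_uminus reducible_add)
  moreover have "reducible (\<lambda>f :: 'n ratfun. f)"
  proof -
    have "dys {#} = (\<lambda>f :: 'n ratfun. f)" by (rule ext) simp
    then show ?thesis using reducible_dys [of "{#} :: 'n multiset"] by (simp only:)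
  qed
  ultimately show ?thesis by blast
qed

section \<open>The rank\<close>

lemma quot_module_coset_eq:
  assumes J: "left_ideal J rat_diffops" and P: "P \<in> carrier rat_diffops" "Q \<in> carrier rat_diffops"
  shows "J +>\<^bsub>rat_diffops\<^esub> P = J +>\<^bsub>rat_diffops\<^esub> Q \<longleftrightarrow> (\<lambda>f. P f - Q f) \<in> J"
proof -
  let ?R = "rat_diffops :: ('a ratfun \<Rightarrow> 'a ratfun) ring"
  interpret R: ring ?R unfolding rat_diffops_def by (rule diffops_ring)
  interpret J: abelian_subgroup J ?R
    using J R.abelian_group_axioms by (intro abelian_subgroupI3) (auto simp: left_ideal_def)
  have "P \<ominus>\<^bsub>?R\<^esub> Q = (\<lambda>f. P f - Q f)"
    using P by (simp add: a_minus_def rat_diffops_def diffops_a_inv)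
  then show ?thesis
    using J.a_rcos_module_minus [OF R.ring_axioms P(2) P(1)]
      R.a_repr_independence [of P J Q, OF _ P(2) J.a_subgroup] J.a_rcos_self [OF P(1)] by auto
qed

text \<open>The scalar multiple is a union over representatives; since \<open>J\<close> absorbs
  \<open>mulop c\<close> from the left, all cosets in this union coincide.\<close>

lemma quot_module_smult:
  assumes J: "left_ideal J rat_diffops" and P: "P \<in> carrier rat_diffops"
  shows "c \<odot>\<^bsub>quot_module J\<^esub> (J +>\<^bsub>rat_diffops\<^esub> P) = J +>\<^bsub>rat_diffops\<^esub> (\<lambda>f. c * P f)"
proof -
  let ?R = "rat_diffops :: ('a ratfun \<Rightarrow> 'a ratfun) ring"
  interpret R: ring ?R unfolding rat_diffops_def by (rule diffops_ring)
  interpret J: abelian_subgroup J ?R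
    using J R.abelian_group_axioms by (intro abelian_subgroupI3) (auto simp: left_ideal_def)
  note J' = J [unfolded rat_diffops_def]
  have comp: "mulop c \<circ> Q = (\<lambda>f. c * Q f)" for Q by (simp add: fun_eq_iff mulop_def)
  have scale: "(\<lambda>f. c * Q f) \<in> carrier rat_diffops" if "Q \<in> carrier rat_diffops" for Q
    using diffops_comp [OF diffops_mulop, of c UNIV Q] that by (simp add: comp rat_diffops_def)
  have "J +>\<^bsub>?R\<^esub> (mulop c \<otimes>\<^bsub>?R\<^esub> Q) = J +>\<^bsub>?R\<^esub> (\<lambda>f. c * P f)" if Q: "Q \<in> J +>\<^bsub>?R\<^esub> P" for Q
  proof -
    have QR: "Q \<in> carrier ?R" using Q P J.a_subset R.a_r_coset_subset_G by blast
    have "J +>\<^bsub>?R\<^esub> Q = J +>\<^bsub>?R\<^esub> P"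
      using R.a_repr_independence [OF Q P J.a_subgroup] by simp
    then have "(\<lambda>f. Q f - P f) \<in> J" using quot_module_coset_eq [OF J QR P] by simp
    from left_ideal_comp [OF J' diffops_mulop this, of c]
    have "(\<lambda>f. c * Q f - c * P f) \<in> J" by (simp add: comp right_diff_distrib)
    then show ?thesis
      using quot_module_coset_eq [OF J scale [OF QR] scale [OF P]] by (simp add: rat_diffops_def comp)
  qed
  moreover have "P \<in> J +>\<^bsub>?R\<^esub> P" using P by (rule J.a_rcos_self)
  ultimately show ?thesis by (auto simp: quot_module_def)
qed

lemma quot_module_add:
  assumes J: "left_ideal J rat_diffops" and P: "P \<in> carrier rat_diffops" "Q \<in> carrier rat_diffops"
  shows "(J +>\<^bsub>rat_diffops\<^esub> P) \<oplus>\<^bsub>quot_module J\<^esub> (J +>\<^bsub>rat_diffops\<^esub> Q) =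
    J +>\<^bsub>rat_diffops\<^esub> (\<lambda>f. P f + Q f)"
proof -
  let ?R = "rat_diffops :: ('a ratfun \<Rightarrow> 'a ratfun) ring"
  interpret R: ring ?R unfolding rat_diffops_def by (rule diffops_ring)
  interpret J: abelian_subgroup J ?R
    using J R.abelian_group_axioms by (intro abelian_subgroupI3) (auto simp: left_ideal_def)
  show ?thesis using J.a_rcos_sum [OF P] by (simp add: quot_module_def) (simp add: rat_diffops_def)
qed

lemma dim_quot_module:
  fixes J :: "('n::finite ratfun \<Rightarrow> 'n ratfun) set" and D :: "'i::finite \<Rightarrow> 'n ratfun \<Rightarrow> 'n ratfun"
  assumes J: "left_ideal J rat_diffops" and D: "\<And>i. D i \<in> carrier rat_diffops"
    and indep: "\<And>a. (\<lambda>f. \<Sum>i\<in>UNIV. a i * D i f) \<in> J \<Longrightarrow> \<forall>i. a i = 0"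
    and span: "\<And>P. P \<in> carrier rat_diffops \<Longrightarrow> \<exists>a. (\<lambda>f. P f - (\<Sum>i\<in>UNIV. a i * D i f)) \<in> J"
  shows "vectorspace.fin_dim ratfun_field (quot_module J)"
    and "vectorspace.dim ratfun_field (quot_module J) = CARD('i)"
proof -
  let ?R = "rat_diffops :: ('n ratfun \<Rightarrow> 'n ratfun) ring"
  let ?K = "ratfun_field :: 'n ratfun ring"
  interpret R: ring ?R unfolding rat_diffops_def by (rule diffops_ring)
  interpret V: vectorspace ?K "quot_module J" by (rule quot_module_vectorspace [OF J])
  define q where "q P = J +>\<^bsub>?R\<^esub> P" for P
  have K [simp]: "carrier ?K = UNIV" "\<zero>\<^bsub>?K\<^esub> = 0" by (simp_all add: ratfun_field_def)
  have carr: "carrier (quot_module J) = q ` carrier ?R"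
    by (auto simp: quot_module_def A_RCOSETS_def' q_def)
  have comb: "(\<lambda>f. \<Sum>i\<in>A. a i * D i f) \<in> carrier ?R" for a A
  proof (induction A rule: infinite_finite_induct)
    case (insert i A)
    have "(\<lambda>f. a i * D i f) \<in> carrier ?R"
      using diffops_comp [OF diffops_mulop, of "a i" UNIV "D i"] D
      by (simp add: rat_diffops_def comp_def mulop_def)
    from diffops_add [OF this [unfolded rat_diffops_def] insert(3) [unfolded rat_diffops_def]] insert(1,2)
    show ?case by (simp add: rat_diffops_def)
  qed (use R.zero_closed in \<open>simp_all add: rat_diffops_def\<close>)
  have eq_iff: "q P = q Q \<longleftrightarrow> (\<lambda>f. P f - Q f) \<in> J" if "P \<in> carrier ?R" "Q \<in> carrier ?R" for P Q
    using quot_module_coset_eq [OF J that] by (simp add: q_def)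
  have zero: "\<zero>\<^bsub>quot_module J\<^esub> = q (\<lambda>_. 0)"
  proof -
    have "J \<subseteq> carrier ?R" using J by (auto simp: left_ideal_def dest: additive_subgroup.a_subset)
    then have "J +>\<^bsub>?R\<^esub> \<zero>\<^bsub>?R\<^esub> = J" by (rule R.a_coset_add_zero)
    then show ?thesis by (simp add: quot_module_def q_def rat_diffops_def)
  qed
  \<comment> \<open>The basis is a set of cosets, so its size is that of the index type only if no
    two indices share a coset. A coincidence would be a relation with coefficients 1 and -1.\<close>
  have inj: "inj (\<lambda>i. q (D i))"
  proof (rule injI, rule ccontr)
    fix i j assume ij: "q (D i) = q (D j)" "i \<noteq> j"
    then have "(\<lambda>f. D i f - D j f) \<in> J" using eq_iff D by blast
    moreover have "D i f - D j f = (\<Sum>k\<in>UNIV. (of_bool (k = i) - of_bool (k = j)) * D k f)" for f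
    proof -
      have "(\<Sum>k\<in>UNIV. (of_bool (k = i) - of_bool (k = j)) * D k f) =
          (\<Sum>k\<in>UNIV. (if k = i then D k f else 0) - (if k = j then D k f else 0))"
        by (rule sum.cong) auto
      also have "\<dots> = D i f - D j f" by (simp add: sum_subtractf)
      finally show ?thesis by simp
    qed
    ultimately have "\<forall>k. of_bool (k = i) - of_bool (k = j) = (0 :: 'n ratfun)"
      using indep [of "\<lambda>k. of_bool (k = i) - of_bool (k = j)"] by simp
    from spec [OF this, of i] ij show False by simp
  qed
  let ?B = "range (\<lambda>i. q (D i))"
  have B: "finite ?B" "?B \<subseteq> carrier (quot_module J)" using D by (auto simp: carr)
  have lincomb: "V.lincomb b ?B = q (\<lambda>f. \<Sum>i\<in>UNIV. b (q (D i)) * D i f)" for b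
  proof -
    have "V.lincomb b ?B = (\<Oplus>\<^bsub>quot_module J\<^esub>i\<in>UNIV. b (q (D i)) \<odot>\<^bsub>quot_module J\<^esub> q (D i))"
      unfolding V.lincomb_def using B inj
      by (intro V.finsum_reindex) auto
    also have "(\<Oplus>\<^bsub>quot_module J\<^esub>i\<in>A. b (q (D i)) \<odot>\<^bsub>quot_module J\<^esub> q (D i)) =
        q (\<lambda>f. \<Sum>i\<in>A. b (q (D i)) * D i f)" for A
    proof (induction A rule: infinite_finite_induct)
      case (insert i A)
      have "(\<lambda>f. b (q (D i)) * D i f) \<in> carrier ?R"
        using comb [of "\<lambda>_. b (q (D i))" "{i}"] by simp
      moreover have "b (q (D i)) \<odot>\<^bsub>quot_module J\<^esub> q (D i) = q (\<lambda>f. b (q (D i)) * D i f)"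
        unfolding q_def by (rule quot_module_smult [OF J D])
      moreover have summand: "b (q (D i)) \<odot>\<^bsub>quot_module J\<^esub> q (D i) \<in> carrier (quot_module J)" for i
        using B by (intro V.smult_closed) auto
      moreover have "(\<Oplus>\<^bsub>quot_module J\<^esub>j\<in>insert i A. b (q (D j)) \<odot>\<^bsub>quot_module J\<^esub> q (D j)) =
          b (q (D i)) \<odot>\<^bsub>quot_module J\<^esub> q (D i) \<oplus>\<^bsub>quot_module J\<^esub>
          (\<Oplus>\<^bsub>quot_module J\<^esub>j\<in>A. b (q (D j)) \<odot>\<^bsub>quot_module J\<^esub> q (D j))"
        using insert summand by (intro V.finsum_insert) auto
      ultimately show ?case
        using insert quot_module_add [OF J _ comb, of "\<lambda>f. b (q (D i)) * D i f" "\<lambda>i. b (q (D i))" A]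
        by (simp add: q_def)
    qed (simp_all add: zero)
    finally show ?thesis .
  qed
  have "V.lin_indpt ?B"
  proof (rule V.finite_lin_indpt2 [OF B])
    fix b assume "V.lincomb b ?B = \<zero>\<^bsub>quot_module J\<^esub>"
    then have "(\<lambda>f. \<Sum>i\<in>UNIV. b (q (D i)) * D i f) \<in> J"
      using eq_iff [OF comb [of "\<lambda>i. b (q (D i))" UNIV] comb [of _ "{}"]]
      by (simp add: lincomb zero)
    then show "\<forall>v\<in>?B. b v = \<zero>\<^bsub>?K\<^esub>" using indep [of "\<lambda>i. b (q (D i))"] by auto
  qed
  moreover have gen: "V.gen_set ?B"
  proof (rule equalityI)
    show "V.span ?B \<subseteq> carrier (quot_module J)" using B by (rule_tac V.span_is_subset2)
    show "carrier (quot_module J) \<subseteq> V.span ?B"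
    proof
      fix v assume "v \<in> carrier (quot_module J)"
      then obtain P where P: "P \<in> carrier ?R" "v = q P" by (auto simp: carr)
      obtain a where a: "(\<lambda>f. P f - (\<Sum>i\<in>UNIV. a i * D i f)) \<in> J" using span P by blast
      \<comment> \<open>A linear combination takes its coefficients on cosets; injectivity lets the
        index be recovered from the coset.\<close>
      let ?b = "\<lambda>w. a (inv_into UNIV (\<lambda>i. q (D i)) w)"
      have "?b (q (D i)) = a i" for i by (simp add: inv_into_f_f [OF inj UNIV_I])
      then have "v = V.lincomb ?b ?B"
        using eq_iff [OF P(1) comb] a by (simp add: lincomb P)
      then show "v \<in> V.span ?B" using V.finite_span [OF B] by auto
    qed
  qed
  ultimately have basis: "V.basis ?B" using B by (simp add: V.basis_def)
  show "V.fin_dim" using B gen unfolding V.fin_dim_def by blast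
  show "V.dim = CARD('i)" using V.dim_basis [OF B(1) basis] card_image [OF inj] by simp
qed

section \<open>The listed generators and the conclusion\<close>

lemma gens_eq:
  "range (\<lambda>i f. 2 * (\<Sum>k\<in>UNIV. xvar i k * dy i (dy k f)) + yvar i * dy i f + f) \<union>
     {(\<lambda>f. dx i j f - 2 * dy i (dy j f)) | i j. i < j} \<union>
     range (\<lambda>i f. dx i i f - dy i (dy i f)) =
   (gens :: ('n::{finite,linorder} ratfun \<Rightarrow> 'n ratfun) set)"
proof -
  have 1: "(\<lambda>i f. 2 * (\<Sum>k\<in>UNIV. xvar i k * dy i (dy k f)) + yvar i * dy i f + f) =
      (gen_y :: 'n \<Rightarrow> _)"
    by (simp add: fun_eq_iff gen_y_def)
  have 2: "(\<lambda>f. dx i j f - 2 * dy i (dy j f)) = gen_x i j" if "i < j" for i j :: 'n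
    using less_imp_neq [OF that] by (simp add: fun_eq_iff gen_x_def)
  have 3: "(\<lambda>f. dx i i f - dy i (dy i f)) = gen_x i i" for i :: 'n
    by (simp add: fun_eq_iff gen_x_def)
  \<comment> \<open>By the symmetry of \<open>gen_x\<close>, the pairs with \<open>i < j\<close> and
    the diagonal exhaust all ordered pairs.\<close>
  have "gen_x i j \<in> {gen_x i j | i j. i < j} \<union> range (\<lambda>i. gen_x i i)" for i j :: 'n
    using gen_x_commute [of i j] by (cases i j rule: linorder_cases) auto
  then have "range (\<lambda>(i, j). gen_x i j) = {gen_x i j | i j :: 'n. i < j} \<union> range (\<lambda>i. gen_x i i)"
    by auto
  moreover have "{(\<lambda>f. dx i j f - 2 * dy i (dy j f)) | i j :: 'n. i < j} = {gen_x i j | i j. i < j}"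
  proof (intro equalityI subsetI)
    fix P assume "P \<in> {(\<lambda>f. dx i j f - 2 * dy i (dy j f)) | i j :: 'n. i < j}"
    then obtain i j :: 'n where "P = (\<lambda>f. dx i j f - 2 * dy i (dy j f))" "i < j" by blast
    with 2 [of i j] show "P \<in> {gen_x i j | i j. i < j}" by blast
  next
    fix P assume "P \<in> {gen_x i j | i j :: 'n. i < j}"
    then obtain i j :: 'n where "P = gen_x i j" "i < j" by blast
    with 2 [of i j] show "P \<in> {(\<lambda>f. dx i j f - 2 * dy i (dy j f)) | i j :: 'n. i < j}"
      by (intro CollectI exI [of _ i] exI [of _ j]) simp
  qed
  ultimately show ?thesis unfolding gens_def 1 3 by (simp only: Un_assoc)
qed

theorem theorem15:
  fixes I :: "('n::{finite,linorder} ratfun \<Rightarrow> 'n ratfun) set"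
  assumes "I = gen_left_ideal weyl_algebra
    (range (\<lambda>i f. 2 * (\<Sum>k\<in>UNIV. xvar i k * dy i (dy k f)) + yvar i * dy i f + f) \<union>
     {(\<lambda>f. dx i j f - 2 * dy i (dy j f)) | i j. i < j} \<union>
     range (\<lambda>i f. dx i i f - dy i (dy i f)))"
  shows "holonomic_rank I = 2 ^ CARD('n)"
proof -
  let ?J = "rel_ideal :: ('n ratfun \<Rightarrow> 'n ratfun) set"
  have ideal: "gen_left_ideal rat_diffops I = ?J"
    unfolding assms gens_eq weyl_algebra_def rat_diffops_def rel_ideal_def
    by (rule gen_left_ideal_trans [OF subset_UNIV gens_weyl])
  have J: "left_ideal ?J rat_diffops" using left_ideal_rel_ideal by (simp add: rat_diffops_def)
  have D: "dys (mset_set S) \<in> carrier rat_diffops" for S :: "'n set"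
    using dys_diffops by (simp add: rat_diffops_def)
  have indep: "\<forall>S. a S = 0" if "(\<lambda>f. \<Sum>S\<in>UNIV. a S * dys (mset_set S) f) \<in> ?J"
    for a :: "'n set \<Rightarrow> 'n ratfun"
    using dys_independent that by (auto simp: rel_ideal_def)
  have span: "\<exists>a. (\<lambda>f. P f - (\<Sum>S\<in>UNIV. a S * dys (mset_set S) f)) \<in> ?J"
    if P: "P \<in> carrier rat_diffops" for P :: "'n ratfun \<Rightarrow> 'n ratfun"
  proof -
    obtain a Q where "Q \<in> ?J" "P = (\<lambda>f. Q f + (\<Sum>S\<in>UNIV. a S * dys (mset_set S) f))"
      using reducible_diffops [of P] P unfolding rat_diffops_def reducible_def by blast
    then show ?thesis by (intro exI [of _ a]) simp
  qed
  note dim = dim_quot_module [of ?J "\<lambda>S. dys (mset_set S)", OF J D indep span]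
  have "CARD('n set) = 2 ^ CARD('n)" by (rule card_set)
  then have "enat CARD('n set) = 2 ^ CARD('n)"
    by (simp add: of_nat_eq_enat [symmetric])
  then show ?thesis
    using dim by (simp add: holonomic_rank_def ideal)
qed

end
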